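(* For every $n\ge3$, we have $$\mathbb{E}[L_{e,n}]=\frac{3}{8}-\frac{1}{8\cdot 3^{n-3}}.$$
   Context: Let $n\ge3$. Select $n$ i.i.d. points uniformly at random on the unit circle and label them $P_1,\ldots,P_n$ in counterclockwise cyclic order. For $1\le i\le n$ consider the perpendicular bisector of $[P_i,P_{i+1}]$ (indices modulo $n$). Almost surely these $n$ lines are pairwise distinct and contain none of the points; they all pass through the center of the circle and divide the plane into $2n$ regions. Each region contains at most one of the points; a region is empty if it contains none of the points. The length of a region is the length of the arc of the circle contained in it, with distances on the circle rescaled so that the total length of the circle is $1$. $L_{e,n}$ is the sum of the lengths of the empty regions. *)

theory Defs
  imports "HOL-Probability.Probability"
begin

definition circle_measure :: "complex measure" where
  "circle_measure = distr (uniform_measure lborel {0..<2 * pi}) borel cis"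

definition perp_bisector :: "complex \<Rightarrow> complex \<Rightarrow> complex set" where
  "perp_bisector p q = {z. (z - midpoint p q) \<bullet> (q - p) = 0}"

text \<open>
  The angles \<theta> 0 < ... < \<theta> (n - 1) < \<theta> 0 + 2 * pi force the labelled points to be
  distinct; no labelling exists when the set S has fewer than n elements.
\<close>
definition ccw_labelling :: "nat \<Rightarrow> (nat \<Rightarrow> complex) \<Rightarrow> complex set \<Rightarrow> bool" where
  "ccw_labelling n P S \<longleftrightarrow>
     P ` {..<n} = S \<and>
     (\<exists>\<theta>::nat \<Rightarrow> real. strict_mono_on {..<n} \<theta> \<and>
        (\<forall>i<n. P i = cis (\<theta> i) \<and> \<theta> i < \<theta> 0 + 2 * pi))"

text \<open>
  Two counterclockwise labellings of S differ by a cyclic shift of the indices, so all of them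
  yield the same bisectors and ranging over all of them is the same as fixing any one.
\<close>
definition bisectors :: "nat \<Rightarrow> complex set \<Rightarrow> complex set set" where
  "bisectors n S =
     {perp_bisector (P i) (P (Suc i mod n)) | P i. ccw_labelling n P S \<and> i < n}"

definition regions :: "nat \<Rightarrow> complex set \<Rightarrow> complex set set" where
  "regions n S = components (- \<Union> (bisectors n S))"

definition empty_regions :: "nat \<Rightarrow> complex set \<Rightarrow> complex set set" where
  "empty_regions n S = {R \<in> regions n S. R \<inter> S = {}}"

definition region_length :: "complex set \<Rightarrow> real" where
  "region_length R = measure circle_measure R"

definition empty_length :: "nat \<Rightarrow> complex set \<Rightarrow> real" where
  "empty_length n S = (\<Sum>R\<in>empty_regions n S. region_length R)"

end

theory Submission
  imports Defs
begin

text \<open>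
  Let \<open>S\<close> be the set of points, \<open>p \<in> S\<close> and \<open>u\<close> an arbitrary point. Along the cyclic order of \<open>S\<close>
  the function \<open>q \<mapsto> q \<bullet> u\<close> increases up to its maximum and then decreases to its minimum, and the
  bisector of two consecutive points separates \<open>u\<close> from \<open>p\<close> iff the functions belonging to \<open>u\<close> and to
  \<open>p\<close> change in opposite directions between them. Hence \<open>u\<close> lies in the region of \<open>p\<close> iff both
  functions have the same maximizer, necessarily \<open>p\<close>, and the same minimizer \<open>b\<close>. Summing over the
  ordered pairs \<open>(p, b)\<close>, the expected length of the nonempty regions is \<open>n (n - 1)\<close> times the
  integral over \<open>p\<close>, \<open>b\<close>, \<open>u\<close> of \<open>F(p, b, u)\<^sup>n\<^sup>-\<^sup>2\<close>, where \<open>F\<close> is the measure of the set of positions for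
  another point that leave \<open>p\<close> and \<open>b\<close> extremal. By rotation and reflection one may take \<open>p = 1\<close> and
  \<open>u\<close> in the upper half plane, where \<open>F\<close> is piecewise linear in the angles of \<open>b\<close> and \<open>u\<close>.
\<close>

section \<open>Cyclically consecutive points\<close>

text \<open>The power \<open>n - 2\<close> arises because, once \<open>p\<close>, \<open>b\<close>
  and \<open>u\<close> are fixed, the remaining points obey independent and identical conditions.
  Integrating the power \<open>m = n - 2\<close> of a piecewise affine function over two angles
  yields the factor \<open>1 / ((m + 1) * (m + 2))\<close>, which cancels against the
  \<open>n * (n - 1)\<close> ordered pairs; only boundary values of the pieces survive. The pieces
  change at the angles \<open>1 / 2\<close> and \<open>2 / 3\<close> of \<open>b\<close>. At
  \<open>2 / 3\<close> the affine expressions take the values \<open>1 / 3\<close> and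
  \<open>2 / 3\<close>; the powers of \<open>2 / 3\<close> from the two sides cancel, which leaves
  \<open>5 / 8 + 27 / 8 * (1 / 3) ^ n\<close> for the nonempty regions. Ties are the main obstacle.
  Strict inequalities throughout make the extremal pair of \<open>u\<close> unique, and the excluded
  positions have measure zero.\<close>

lemma inner_cis_diff:
  "(cis y - cis x) \<bullet> u = 2 * sin ((y - x) / 2) * (cis ((x + y) / 2 + pi / 2) \<bullet> u)"
proof -
  define m d where "m = (x + y) / 2" and "d = (y - x) / 2"
  have yx: "y = m + d" "x = m - d" by (simp_all add: m_def d_def field_simps)
  show ?thesis
    unfolding m_def[symmetric] d_def[symmetric] yx
    by (simp add: inner_complex_def cos_add sin_add cos_diff sin_diff algebra_simps)
qed

text \<open>\<open>cis b\<close> is a linear combination of \<open>cis a\<close> and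
  \<open>cis c\<close>. The coefficients are positive when the three angles increase within less
  than half a turn.\<close>

lemma sin_inner_cis:
  "sin (c - a) * (cis b \<bullet> u) = sin (c - b) * (cis a \<bullet> u) + sin (b - a) * (cis c \<bullet> u)"
proof -
  have "sin (c - a) * cos b = sin (c - b) * cos a + sin (b - a) * cos c"
       "sin (c - a) * sin b = sin (c - b) * sin a + sin (b - a) * sin c"
    by (simp_all add: sin_diff algebra_simps)
  then have "(sin (c - a) * cos b) * Re u + (sin (c - a) * sin b) * Im u =
      (sin (c - b) * cos a + sin (b - a) * cos c) * Re u + (sin (c - b) * sin a + sin (b - a) * sin c) * Im u"
    by simp
  then show ?thesis
    by (simp add: inner_complex_def distrib_left distrib_right mult.assoc)
qed

text \<open>
  The chord through \<open>cis w\<close> orthogonal to \<open>u\<close> cuts off one arc, so three points cannot lie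
  alternately on its two sides.
\<close>
lemma chord_ge:
  assumes "w < x" "x < y" "y < z" "z < w + 2 * pi"
    and "cis w \<bullet> u \<le> cis x \<bullet> u" "cis w \<bullet> u \<le> cis z \<bullet> u"
  shows "cis w \<bullet> u \<le> cis y \<bullet> u"
    and "cis w \<bullet> u < cis x \<bullet> u \<Longrightarrow> cis w \<bullet> u < cis y \<bullet> u"
proof -
  define Y where "Y t = cis ((w + t) / 2 + pi / 2) \<bullet> u" for t
  have diff: "cis t \<bullet> u - cis w \<bullet> u = 2 * sin ((t - w) / 2) * Y t" for t
    using inner_cis_diff[of t w u] by (simp add: Y_def inner_diff_left)
  have pos: "sin ((t - w) / 2) > 0" if "w < t" "t \<le> z" for t
    using that assms by (intro sin_gt_zero) auto
  \<comment> \<open>\<open>Y t\<close> carries the sign of the difference to \<open>w\<close>, and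
    it lives at halved angles. These span less than half a turn, so the direction belonging to
    \<open>y\<close> is a positive combination of those of \<open>x\<close> and
    \<open>z\<close>.\<close>
  have key: "sin ((z - x) / 2) * Y y = sin ((z - y) / 2) * Y x + sin ((y - x) / 2) * Y z"
    using sin_inner_cis[of "(w + z) / 2 + pi / 2" "(w + x) / 2 + pi / 2" "(w + y) / 2 + pi / 2" u]
    by (simp add: Y_def diff_divide_distrib add_divide_distrib)
  have s: "sin ((z - x) / 2) > 0" "sin ((z - y) / 2) > 0" "sin ((y - x) / 2) > 0"
    using assms by (auto intro!: sin_gt_zero)
  have ge: "Y t \<ge> 0 \<longleftrightarrow> cis w \<bullet> u \<le> cis t \<bullet> u" and gt: "Y t > 0 \<longleftrightarrow> cis w \<bullet> u < cis t \<bullet> u"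
    if "w < t" "t \<le> z" for t
    using diff[of t] pos[OF that] by (smt (verit) zero_le_mult_iff zero_less_mult_iff)+
  have "Y x \<ge> 0" "Y z \<ge> 0" using ge assms by auto
  then have "sin ((z - x) / 2) * Y y \<ge> 0" unfolding key using s by simp
  then show "cis w \<bullet> u \<le> cis y \<bullet> u" using s ge[of y] assms by (simp add: zero_le_mult_iff)
  assume "cis w \<bullet> u < cis x \<bullet> u"
  then have "Y x > 0" using gt assms by auto
  then have "sin ((z - x) / 2) * Y y > 0" unfolding key using s \<open>Y z \<ge> 0\<close>
    by (simp add: add_pos_nonneg)
  then show "cis w \<bullet> u < cis y \<bullet> u" using s gt[of y] assms by (simp add: zero_less_mult_iff)
qed

text \<open>
  \<open>c\<close> is the successor of \<open>a\<close>: all of \<open>S\<close> lies on the counterclockwise arc from \<open>c\<close> around to \<open>a\<close>.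
\<close>
definition consecutive :: "complex set \<Rightarrow> complex \<Rightarrow> complex \<Rightarrow> bool" where
  "consecutive S a c \<longleftrightarrow> a \<in> S \<and> c \<in> S \<and>
     (\<exists>\<gamma> \<alpha>. c = cis \<gamma> \<and> a = cis \<alpha> \<and> \<gamma> < \<alpha> \<and> \<alpha> < \<gamma> + 2 * pi \<and> S \<subseteq> cis ` {\<gamma>..\<alpha>})"

lemma cis_eq_iff_near:
  assumes "\<bar>x - y\<bar> < 2 * pi"
  shows "cis x = cis y \<longleftrightarrow> x = y"
proof
  assume "cis x = cis y"
  then have "cis (x - y) = 1" by (simp add: cis_divide[symmetric])
  then have "cos (x - y) = 1" by (simp add: complex_eq_iff)
  then obtain k :: int where k: "x - y = of_int k * 2 * pi"
    using cos_one_2pi_int by auto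
  then have "\<bar>of_int k\<bar> * (2 * pi) < 1 * (2 * pi)" using assms by (simp add: abs_mult)
  then have "\<bar>real_of_int k\<bar> < 1" by (subst (asm) mult_less_cancel_right) auto
  then have "k = 0" by linarith
  then show "x = y" using k by simp
qed simp

lemma obtain_angle:
  assumes "norm z = 1"
  obtains t where "z = cis t" "w \<le> t" "t < w + 2 * pi"
proof -
  have "norm (z * cis (- w)) = 1" using assms by (simp add: norm_mult)
  then have "z * cis (- w) = cis (Arg2pi (z * cis (- w)))"
    using Arg2pi_eq[of "z * cis (-w)"] by (simp add: cis_conv_exp del: norm_mult)
  then have "z = cis (w + Arg2pi (z * cis (- w)))"
    by (metis add.right_inverse cis_mult cis_zero mult.assoc mult.commute mult.right_neutral)
  then show ?thesis
    using that Arg2pi[of "z * cis (-w)"] by fastforce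
qed

lemma inj_on_cis:
  assumes "\<alpha> < \<gamma> + 2 * pi" shows "inj_on cis {\<gamma>..\<alpha>}"
  by (rule inj_onI, subst (asm) cis_eq_iff_near) (use assms in auto)

text \<open>Cutting the circle open at \<open>p\<close>, the first and the last of the remaining
  angles give the successor and the predecessor. They coincide if \<open>S\<close> has two points,
  hence only \<open>x \<le> z\<close>.\<close>

lemma neighbours:
  assumes "finite S" "S \<subseteq> sphere 0 1" "card S \<ge> 2" "p \<in> S"
  obtains w x z where "p = cis w" "w < x" "x \<le> z" "z < w + 2 * pi"
    "consecutive S p (cis x)" "consecutive S (cis z) p" "S \<subseteq> cis ` insert w {x..z}"
proof -
  have "norm p = 1" using assms by auto
  then obtain w where w: "p = cis w" using obtain_angle[of p 0] by metis
  have "\<forall>q\<in>S. \<exists>t. q = cis t \<and> w \<le> t \<and> t < w + 2 * pi"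
    using obtain_angle assms(2) by (metis mem_sphere_0 subsetD)
  then obtain ang where ang: "\<And>q. q \<in> S \<Longrightarrow> q = cis (ang q) \<and> w \<le> ang q \<and> ang q < w + 2 * pi"
    by metis
  define T where "T = ang ` (S - {p})"
  have "S - {p} \<noteq> {}" using assms by (metis card_Diff_singleton card.empty diff_is_0_eq
     not_less_eq_eq numeral_2_eq_2 One_nat_def le_zero_eq Suc_le_D nat.distinct(1))
  then have T: "finite T" "T \<noteq> {}" using assms by (auto simp: T_def)
  define x z where "x = Min T" and "z = Max T"
  have bnd: "w < t \<and> t < w + 2 * pi \<and> cis t \<in> S" if t: "t \<in> T" for t
  proof -
    obtain q where q: "q \<in> S" "q \<noteq> p" "t = ang q" using t by (auto simp: T_def)
    have "ang q \<noteq> w" using q ang[of q] w by auto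
    then show ?thesis using ang[of q] q by auto
  qed
  have mem: "x \<in> T" "z \<in> T" using T by (auto simp: x_def z_def)
  have S: "S \<subseteq> cis ` insert w {x..z}"
  proof
    fix q assume q: "q \<in> S"
    show "q \<in> cis ` insert w {x..z}"
    proof (cases "q = p")
      case False
      then have "ang q \<in> {x..z}" using q T by (auto simp: T_def x_def z_def)
      then show ?thesis using ang[OF q] by blast
    qed (use w in auto)
  qed
  \<comment> \<open>The arc that starts at the successor has to end at \<open>p\<close>, so there
    \<open>p\<close> gets the angle \<open>w + 2 * pi\<close> instead of \<open>w\<close>.\<close>
  have w2: "cis w = cis (w + 2 * pi)" by (simp add: cis_mult[symmetric])
  have "insert w {x..z} \<subseteq> {w..z}" using bnd mem by fastforce
  then have S1: "S \<subseteq> cis ` {w..z}" using S by blast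
  have "S \<subseteq> cis ` {x..w + 2 * pi}"
  proof
    fix q assume "q \<in> S"
    then obtain t where t: "q = cis t" "t = w \<or> t \<in> {x..z}" using S by auto
    then show "q \<in> cis ` {x..w + 2 * pi}"
      using bnd[OF mem(1)] bnd[OF mem(2)] w2 by (cases "t = w") auto
  qed
  then have "consecutive S p (cis x)" unfolding consecutive_def
    using bnd[OF mem(1)] assms(4) w w2 by (intro conjI exI[of _ x] exI[of _ "w + 2 * pi"]) auto
  moreover have "consecutive S (cis z) p" unfolding consecutive_def
    using bnd[OF mem(2)] assms(4) w S1 by (intro conjI exI[of _ w] exI[of _ z]) auto
  moreover have "x \<le> z" using T by (simp add: x_def z_def)
  ultimately show ?thesis using that w bnd[OF mem(1)] bnd[OF mem(2)] S by blast
qed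

definition extremal :: "complex set \<Rightarrow> complex \<Rightarrow> complex \<Rightarrow> complex \<Rightarrow> bool" where
  "extremal S u p b \<longleftrightarrow>
     (\<forall>q\<in>S - {p}. q \<bullet> u < p \<bullet> u) \<and> (\<forall>q\<in>S - {b}. b \<bullet> u < q \<bullet> u)"

text \<open>Both neighbours lie strictly on one side of the chord through \<open>b\<close>
  orthogonal to \<open>u\<close>, and \<open>chord_ge\<close> keeps the whole arc between them on
  that side. Applied to \<open>- u\<close> this also turns local maxima into global ones.\<close>

lemma local_min_global:
  assumes S: "finite S" "S \<subseteq> sphere 0 1" "card S \<ge> 2" "b \<in> S"
    and succ: "\<And>c. consecutive S b c \<Longrightarrow> b \<bullet> u < c \<bullet> u"
    and pred: "\<And>a. consecutive S a b \<Longrightarrow> b \<bullet> u < a \<bullet> u"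
  shows "\<forall>q\<in>S - {b}. b \<bullet> u < q \<bullet> u"
proof
  fix q assume q: "q \<in> S - {b}"
  obtain w x z where n: "b = cis w" "w < x" "x \<le> z" "z < w + 2 * pi"
    "consecutive S b (cis x)" "consecutive S (cis z) b" "S \<subseteq> cis ` insert w {x..z}"
    using neighbours[OF S] by blast
  have lt: "cis w \<bullet> u < cis x \<bullet> u" "cis w \<bullet> u < cis z \<bullet> u" using succ pred n by auto
  obtain y where y: "q = cis y" "y \<in> {x..z}" using q n by auto
  consider "y = x" | "y = z" | "x < y" "y < z" using y by fastforce
  then show "b \<bullet> u < q \<bullet> u"
    using lt chord_ge(2)[of w x y z u] n y by cases auto
qed

text \<open>The conclusion depends on the order of \<open>p\<close> and \<open>b\<close> along the
  arc but not on \<open>u\<close>, so two functions with the same extremal pair change in the same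
  direction at every consecutive pair. A wrong sign would put \<open>a\<close> and the first of the
  two extremal points on one side of the chord through \<open>c\<close>, hence the second one too,
  against its extremality.\<close>

lemma consecutive_sign:
  assumes "consecutive S a c" "extremal S u p b" "p \<in> S" "b \<in> S" "p \<noteq> b"
    and "c = cis \<gamma>" "a = cis \<alpha>" "\<gamma> < \<alpha>" "\<alpha> < \<gamma> + 2 * pi"
    and "p = cis x" "x \<in> {\<gamma>..\<alpha>}" "b = cis y" "y \<in> {\<gamma>..\<alpha>}"
  shows "x < y \<Longrightarrow> a \<bullet> u < c \<bullet> u" and "y < x \<Longrightarrow> c \<bullet> u < a \<bullet> u"
proof -
  have ac: "a \<in> S" "c \<in> S" using assms by (auto simp: consecutive_def)
  have p: "q \<bullet> u < p \<bullet> u" if "q \<in> S" "q \<noteq> p" for q using assms that by (auto simp: extremal_def)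
  have b: "b \<bullet> u < q \<bullet> u" if "q \<in> S" "q \<noteq> b" for q using assms that by (auto simp: extremal_def)
  have "a \<noteq> c" using cis_eq_iff_near[of \<alpha> \<gamma>] assms by auto
  show "a \<bullet> u < c \<bullet> u" if xy: "x < y"
  proof (rule ccontr)
    assume neg: "\<not> a \<bullet> u < c \<bullet> u"
    have "p \<noteq> a" using cis_eq_iff_near[of x \<alpha>] assms xy by auto
    then have "p \<noteq> c" using neg p[OF ac(1)] by auto
    have "b \<noteq> c" using cis_eq_iff_near[of y \<gamma>] assms xy by auto
    then have "b \<noteq> a" using neg b[OF ac(2)] by auto
    have "\<gamma> < x" "y < \<alpha>" using assms \<open>p \<noteq> c\<close> \<open>b \<noteq> a\<close> by (auto simp: order.order_iff_strict)
    then have "c \<bullet> u \<le> b \<bullet> u"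
      using chord_ge(1)[of \<gamma> x y \<alpha> u] assms xy neg p[OF ac(2)] \<open>p \<noteq> c\<close> by auto
    then show False using b[OF ac(2)] \<open>b \<noteq> c\<close> by auto
  qed
  show "c \<bullet> u < a \<bullet> u" if xy: "y < x"
  proof (rule ccontr)
    assume neg: "\<not> c \<bullet> u < a \<bullet> u"
    have "b \<noteq> a" using cis_eq_iff_near[of y \<alpha>] assms xy by auto
    then have "b \<noteq> c" using neg b[OF ac(1)] by auto
    have "p \<noteq> c" using cis_eq_iff_near[of x \<gamma>] assms xy by auto
    then have "p \<noteq> a" using neg p[OF ac(2)] by auto
    have "\<gamma> < y" "x < \<alpha>" using assms \<open>b \<noteq> c\<close> \<open>p \<noteq> a\<close> by (auto simp: order.order_iff_strict)
    then have "c \<bullet> (- u) \<le> p \<bullet> (- u)"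
      using chord_ge(1)[of \<gamma> y x \<alpha> "- u"] assms xy neg b[OF ac(2)] \<open>b \<noteq> c\<close> by auto
    then show False using p[OF ac(2)] \<open>p \<noteq> c\<close> by auto
  qed
qed

text \<open>From left to right, every sign is read off the order of \<open>p\<close> and
  \<open>b\<close>. Conversely, equal signs carry the extremality of \<open>p\<close> and
  \<open>b\<close> among their neighbours from the function of \<open>p\<close> to that of
  \<open>u\<close>, and local extrema are global.\<close>

lemma same_side_iff_extremal:
  assumes S: "finite S" "S \<subseteq> sphere 0 1" "card S \<ge> 2" "p \<in> S"
  shows "(\<exists>b\<in>S. extremal S u p b \<and> extremal S p p b) \<longleftrightarrow>
    (\<forall>a c. consecutive S a c \<longrightarrow>
       (c - a) \<bullet> u \<noteq> 0 \<and> (c - a) \<bullet> p \<noteq> 0 \<and> (0 < (c - a) \<bullet> u \<longleftrightarrow> 0 < (c - a) \<bullet> p))"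
    (is "?L \<longleftrightarrow> ?R")
proof
  assume ?L
  then obtain b where b: "b \<in> S" "extremal S u p b" "extremal S p p b" by blast
  obtain q where q: "q \<in> S" "q \<noteq> p"
    using S by (metis card_le_Suc0_iff_eq not_less_eq_eq numeral_2_eq_2)
  have "p \<noteq> b" using b q unfolding extremal_def by (metis DiffI empty_iff insert_iff order.asym)
  show ?R
  proof (intro allI impI)
    fix a c assume c: "consecutive S a c"
    then obtain \<gamma> \<alpha> where g: "c = cis \<gamma>" "a = cis \<alpha>" "\<gamma> < \<alpha>" "\<alpha> < \<gamma> + 2 * pi" "S \<subseteq> cis ` {\<gamma>..\<alpha>}"
      unfolding consecutive_def by blast
    obtain x where x: "p = cis x" "x \<in> {\<gamma>..\<alpha>}" using g S by auto
    obtain y where y: "b = cis y" "y \<in> {\<gamma>..\<alpha>}" using g b by auto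
    have "x < y \<or> y < x" using x y \<open>p \<noteq> b\<close> by (metis linorder_less_linear)
    then show "(c - a) \<bullet> u \<noteq> 0 \<and> (c - a) \<bullet> p \<noteq> 0 \<and> (0 < (c - a) \<bullet> u \<longleftrightarrow> 0 < (c - a) \<bullet> p)"
      using consecutive_sign[OF c b(2) S(4) b(1) \<open>p \<noteq> b\<close> g(1-4) x y]
        consecutive_sign[OF c b(3) S(4) b(1) \<open>p \<noteq> b\<close> g(1-4) x y]
      by (auto simp: inner_diff_left)
  qed
next
  assume ?R
  then have R: "c \<bullet> u \<noteq> a \<bullet> u" "c \<bullet> p \<noteq> a \<bullet> p" "a \<bullet> u < c \<bullet> u \<longleftrightarrow> a \<bullet> p < c \<bullet> p"
      "c \<bullet> u < a \<bullet> u \<longleftrightarrow> c \<bullet> p < a \<bullet> p"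
    if "consecutive S a c" for a c
    using that by (fastforce simp: inner_diff_left)+
  have pp: "q \<bullet> p < p \<bullet> p" if "q \<in> S" "q \<noteq> p" for q
  proof -
    have "norm q = 1" "norm p = 1" using that S by auto
    then have "q \<bullet> q = 1" "p \<bullet> p = 1" by (simp_all add: norm_eq_sqrt_inner)
    moreover have "(q - p) \<bullet> (q - p) > 0" using that by simp
    ultimately show ?thesis by (simp add: inner_diff_left inner_diff_right inner_commute)
  qed
  have cne: "a \<noteq> c \<and> a \<in> S \<and> c \<in> S" if ac: "consecutive S a c" for a c
  proof -
    obtain \<gamma> \<alpha> where "c = cis \<gamma>" "a = cis \<alpha>" "\<gamma> < \<alpha>" "\<alpha> < \<gamma> + 2 * pi"
      using ac unfolding consecutive_def by blast
    then show ?thesis using cis_eq_iff_near[of \<alpha> \<gamma>] ac by (auto simp: consecutive_def)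
  qed
  \<comment> \<open>A weak minimizer for \<open>p\<close>; since no sign vanishes, it is strictly
    below its neighbours.\<close>
  obtain b where b: "b \<in> S" "\<And>q. q \<in> S \<Longrightarrow> b \<bullet> p \<le> q \<bullet> p"
    using S arg_min_if_finite[of S "\<lambda>q. q \<bullet> p"] by (metis empty_iff not_le)
  have bn: "b \<bullet> p < c \<bullet> p" "b \<bullet> u < c \<bullet> u" if "consecutive S b c" for c
    using R[OF that] cne[OF that] b(2)[of c] by auto
  have bm: "b \<bullet> p < a \<bullet> p" "b \<bullet> u < a \<bullet> u" if "consecutive S a b" for a
    using R[OF that] cne[OF that] b(2)[of a] by auto
  have pu: "\<forall>q\<in>S - {p}. p \<bullet> (- u) < q \<bullet> (- u)"
  proof (rule local_min_global[OF S])
    show "p \<bullet> (- u) < c \<bullet> (- u)" if "consecutive S p c" for c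
      using R[OF that] cne[OF that] pp[of c] by auto
    show "p \<bullet> (- u) < a \<bullet> (- u)" if "consecutive S a p" for a
      using R[OF that] cne[OF that] pp[of a] by auto
  qed
  have "extremal S u p b"
    using pu local_min_global[OF S(1-3) b(1), of u] bn bm by (auto simp: extremal_def)
  moreover have "extremal S p p b"
    using pp local_min_global[OF S(1-3) b(1), of p] bn bm by (auto simp: extremal_def)
  ultimately show ?L using b by blast
qed

section \<open>Regions of the bisector arrangement\<close>

lemma consecutive_neq: "consecutive S a c \<Longrightarrow> a \<noteq> c"
  unfolding consecutive_def using cis_eq_iff_near by fastforce

text \<open>Sorting the angles on the arc from \<open>c\<close> to \<open>a\<close> starts the
  labelling at \<open>c\<close>, so the given pair becomes the wrap-around pair with indices
  \<open>card S - 1\<close> and \<open>0\<close>.\<close>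

lemma consecutive_imp_labelling:
  assumes "finite S" "consecutive S a c"
  obtains P where "ccw_labelling (card S) P S" "P 0 = c" "P (card S - 1) = a"
proof -
  obtain \<gamma> \<alpha> where g: "c = cis \<gamma>" "a = cis \<alpha>" "\<gamma> < \<alpha>" "\<alpha> < \<gamma> + 2 * pi" "S \<subseteq> cis ` {\<gamma>..\<alpha>}"
    and ac: "a \<in> S" "c \<in> S"
    using assms unfolding consecutive_def by blast
  define T where "T = {t \<in> {\<gamma>..\<alpha>}. cis t \<in> S}"
  have bij: "bij_betw cis T S"
    unfolding bij_betw_def
  proof
    show "inj_on cis T" by (rule inj_on_subset[OF inj_on_cis[OF g(4)]]) (auto simp: T_def)
    show "cis ` T = S" using g(5) by (auto simp: T_def)
  qed
  have T: "finite T" "card T = card S"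
    using bij assms(1) bij_betw_finite bij_betw_same_card by blast+
  define L where "L = sorted_list_of_set T"
  have L: "length L = card S" "set L = T" "sorted_wrt (<) L"
    using T by (simp_all add: L_def)
  have mono: "L ! i < L ! j" if "i < j" "j < card S" for i j
    using sorted_wrt_nth_less[OF L(3)] that L(1) by simp
  have mem: "L ! i \<in> T" if "i < card S" for i using that L nth_mem by metis
  have pos: "card S > 0" using assms ac by (auto simp: card_gt_0_iff)
  have ends: "\<gamma> \<in> T" "\<alpha> \<in> T" using g ac by (auto simp: T_def)
  then obtain k k' where k: "k < card S" "L ! k = \<gamma>" "k' < card S" "L ! k' = \<alpha>"
    using L by (metis in_set_conv_nth)
  have L0: "L ! 0 = \<gamma>" using mono[of 0 k] mem[of 0] pos k by (cases "k = 0") (auto simp: T_def)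
  have L1: "L ! (card S - 1) = \<alpha>"
  proof (cases "k' = card S - 1")
    case False
    then have "k' < card S - 1" using k by simp
    then show ?thesis using mono[of k' "card S - 1"] mem[of "card S - 1"] pos k by (simp add: T_def)
  qed (use k in simp)
  have "cis ` (\<lambda>i. L ! i) ` {..<card S} = S"
    using L bij by (metis bij_betw_def nth_image lessThan_atLeast0 take_all_iff order_refl)
  then have "ccw_labelling (card S) (\<lambda>i. cis (L ! i)) S"
    unfolding ccw_labelling_def image_image
    using mem L0 g(4) by (auto intro!: exI[of _ "\<lambda>i. L ! i"] strict_mono_onI mono simp: T_def)
      (meson atLeastAtMost_iff le_less_trans)
  then show ?thesis using that L0 L1 g by auto
qed

lemma labelling_angles:
  assumes "ccw_labelling n P S"
  obtains \<theta> :: "nat \<Rightarrow> real" where "P ` {..<n} = S"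
    "\<forall>i j. i < j \<longrightarrow> j < n \<longrightarrow> \<theta> i < \<theta> j"
    "\<forall>i<n. P i = cis (\<theta> i) \<and> \<theta> i < \<theta> 0 + 2 * pi"
  using assms unfolding ccw_labelling_def strict_mono_on_def
  by (meson lessThan_iff order.strict_trans)

lemma labelling_imp_consecutive:
  assumes labelling: "ccw_labelling n P S" and i: "i < n" and n: "n \<ge> 2"
  shows "consecutive S (P i) (P (Suc i mod n))"
proof -
  obtain \<theta> :: "nat \<Rightarrow> real" where S: "P ` {..<n} = S"
    and 1: "\<forall>i j. i < j \<longrightarrow> j < n \<longrightarrow> \<theta> i < \<theta> j"
    and 2: "\<forall>i<n. P i = cis (\<theta> i) \<and> \<theta> i < \<theta> 0 + 2 * pi"
    using labelling by (rule labelling_angles)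
  from 1 have mono: "\<theta> i < \<theta> j" if "i < j" "j < n" for i j using that by blast
  from 2 have P: "P i = cis (\<theta> i)" "\<theta> i < \<theta> 0 + 2 * pi" if "i < n" for i using that by blast+
  have mono': "\<theta> i \<le> \<theta> j" if "i \<le> j" "j < n" for i j
    using mono[of i j] that by (cases "i = j") auto
  have shift: "cis (t + 2 * pi) = cis t" for t by (simp add: cis_mult[symmetric])
  have mem: "P i \<in> S" "P (Suc i mod n) \<in> S" using i S by auto
  show ?thesis
  proof (cases "Suc i = n")
    case True
    have "S \<subseteq> cis ` {\<theta> 0..\<theta> i}"
    proof
      fix q assume "q \<in> S"
      then obtain j where "j < n" "q = P j" using S by auto
      then show "q \<in> cis ` {\<theta> 0..\<theta> i}" using P(1)[of j] mono'[of 0 j] mono'[of j i] True by auto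
    qed
    moreover have "P (Suc i mod n) = cis (\<theta> 0)" "P i = cis (\<theta> i)" "\<theta> 0 < \<theta> i" "\<theta> i < \<theta> 0 + 2 * pi"
      using P[of 0] P[of i] mono[of 0 i] True i n by auto
    ultimately show ?thesis unfolding consecutive_def using mem by blast
  next
    case False
    then have m: "Suc i mod n = Suc i" "Suc i < n" using i by auto
    \<comment> \<open>The labels after \<open>i\<close> keep their angles, those up to
      \<open>i\<close> move on by a full turn.\<close>
    have "S \<subseteq> cis ` {\<theta> (Suc i)..\<theta> i + 2 * pi}"
    proof
      fix q assume "q \<in> S"
      then obtain j where j: "j < n" "q = P j" using S by auto
      show "q \<in> cis ` {\<theta> (Suc i)..\<theta> i + 2 * pi}"
      proof (cases "Suc i \<le> j")
        case True
        then have "\<theta> (Suc i) \<le> \<theta> j" "\<theta> j \<le> \<theta> i + 2 * pi"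
          using mono'[of "Suc i" j] mono'[of 0 i] P(2)[of j] i j by auto
        then show ?thesis using j P(1)[of j] by auto
      next
        case False
        then have "\<theta> (Suc i) \<le> \<theta> j + 2 * pi" "\<theta> j + 2 * pi \<le> \<theta> i + 2 * pi"
          using mono'[of j i] mono'[of 0 j] P(2)[of "Suc i"] m i j by auto
        then show ?thesis using j P(1)[of j] shift[of "\<theta> j"] by (metis atLeastAtMost_iff imageI)
      qed
    qed
    moreover have "P (Suc i mod n) = cis (\<theta> (Suc i))" "P i = cis (\<theta> i + 2 * pi)"
        "\<theta> (Suc i) < \<theta> i + 2 * pi" "\<theta> i + 2 * pi < \<theta> (Suc i) + 2 * pi"
      using P(1)[of "Suc i"] P(1)[OF i] P(2)[of "Suc i"] mono[of i "Suc i"] mono'[of 0 i] m shift[of "\<theta> i"] by auto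
    ultimately show ?thesis unfolding consecutive_def using mem by blast
  qed
qed

lemma bisectors_eq:
  assumes "finite S" "card S \<ge> 2"
  shows "bisectors (card S) S = {perp_bisector a c | a c. consecutive S a c}"
proof
  show "bisectors (card S) S \<subseteq> {perp_bisector a c | a c. consecutive S a c}"
    using labelling_imp_consecutive assms(2) unfolding bisectors_def by blast
  show "{perp_bisector a c | a c. consecutive S a c} \<subseteq> bisectors (card S) S"
  proof clarify
    fix a c assume "consecutive S a c"
    then obtain P where P: "ccw_labelling (card S) P S" "P 0 = c" "P (card S - 1) = a"
      using consecutive_imp_labelling[OF assms(1)] by metis
    have "Suc (card S - 1) mod card S = 0" "card S - 1 < card S" using assms(2) by auto
    then show "perp_bisector a c \<in> bisectors (card S) S"
      unfolding bisectors_def using P by (metis (mono_tags, lifting) mem_Collect_eq)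
  qed
qed

text \<open>The midpoint of two unit vectors is orthogonal to their difference. So the bisectors are
  lines through the origin, and their sides are given by signs of linear functionals.\<close>

lemma perp_bisector_sphere:
  assumes "norm a = 1" "norm c = 1"
  shows "perp_bisector a c = {z. (c - a) \<bullet> z = 0}"
proof -
  have "a \<bullet> a = 1" "c \<bullet> c = 1" using assms by (simp_all add: dot_square_norm)
  then have "midpoint a c \<bullet> (c - a) = 0"
    by (simp add: midpoint_def inner_add_left inner_diff_right inner_commute[of c a])
  then have "(z - midpoint a c) \<bullet> (c - a) = (c - a) \<bullet> z" for z
    by (metis diff_zero inner_commute inner_diff_left)
  then show ?thesis unfolding perp_bisector_def by simp
qed

definition off_bisectors :: "complex set \<Rightarrow> complex set" where
  "off_bisectors S = {z. \<forall>a c. consecutive S a c \<longrightarrow> (c - a) \<bullet> z \<noteq> 0}"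

lemma off_bisectors:
  assumes "finite S" "card S \<ge> 2" "S \<subseteq> sphere 0 1"
  shows "- \<Union> (bisectors (card S) S) = off_bisectors S"
proof -
  have "perp_bisector a c = {z. (c - a) \<bullet> z = 0}" if "consecutive S a c" for a c
    using that assms(3) by (intro perp_bisector_sphere) (auto simp: consecutive_def)
  then show ?thesis unfolding bisectors_eq[OF assms(1,2)] off_bisectors_def by blast
qed

text \<open>A set with prescribed signs is convex, hence connected by segments. A change of sign
  within a connected set would hit a bisector by the intermediate value theorem.\<close>

lemma connected_component_off_bisectors:
  assumes z: "z \<in> off_bisectors S"
  shows "connected_component_set (off_bisectors S) z = {w \<in> off_bisectors S.
    \<forall>a c. consecutive S a c \<longrightarrow> (0 < (c - a) \<bullet> z \<longleftrightarrow> 0 < (c - a) \<bullet> w)}" (is "_ = ?K")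
proof (intro equalityI subsetI)
  fix w assume "w \<in> connected_component_set (off_bisectors S) z"
  then obtain T where T: "connected T" "T \<subseteq> off_bisectors S" "z \<in> T" "w \<in> T"
    by (auto simp: connected_component_def)
  have "0 < (c - a) \<bullet> z \<longleftrightarrow> 0 < (c - a) \<bullet> w" if "consecutive S a c" for a c
  proof (rule ccontr)
    assume "\<not> ?thesis"
    then have "\<exists>y\<in>T. (c - a) \<bullet> y = 0"
      using connected_ivt_hyperplane[OF T(1), of z w "c - a" 0]
        connected_ivt_hyperplane[OF T(1), of w z "c - a" 0] T by fastforce
    then show False using T(2) that by (auto simp: off_bisectors_def)
  qed
  then show "w \<in> ?K" using T by auto
next
  fix w assume w: "w \<in> ?K"
  have "closed_segment z w \<subseteq> off_bisectors S"
  proof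
    fix y assume "y \<in> closed_segment z w"
    then obtain t where t: "y = (1 - t) *\<^sub>R z + t *\<^sub>R w" "0 \<le> t" "t \<le> 1" by (auto simp: in_segment)
    have "(c - a) \<bullet> y \<noteq> 0" if c: "consecutive S a c" for a c
    proof -
      have y: "(c - a) \<bullet> y = (1 - t) * ((c - a) \<bullet> z) + t * ((c - a) \<bullet> w)"
        by (simp add: t inner_add_right)
      have s: "0 < (c - a) \<bullet> z \<longleftrightarrow> 0 < (c - a) \<bullet> w" "(c - a) \<bullet> z \<noteq> 0" "(c - a) \<bullet> w \<noteq> 0"
        using z w c by (auto simp: off_bisectors_def)
      have "0 < (c - a) \<bullet> y" if "0 < (c - a) \<bullet> z"
        unfolding y using s that t(2,3) by (cases "t = 1") (auto intro: add_pos_nonneg)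
      moreover have "(c - a) \<bullet> y < 0" if "(c - a) \<bullet> z < 0"
      proof -
        have "(c - a) \<bullet> w < 0" using s that by linarith
        then show ?thesis unfolding y using that t(2,3)
          by (cases "t = 1") (auto intro!: add_neg_nonpos mult_pos_neg mult_nonneg_nonpos)
      qed
      ultimately show ?thesis using s by linarith
    qed
    then show "y \<in> off_bisectors S" by (simp add: off_bisectors_def)
  qed
  then show "w \<in> connected_component_set (off_bisectors S) z"
    unfolding connected_component_def mem_Collect_eq
    by (intro exI[of _ "closed_segment z w"]) auto
qed

lemma finite_consecutive:
  assumes "finite S" shows "finite {(a, c). consecutive S a c}"
  by (rule finite_subset[of _ "S \<times> S"]) (use assms in \<open>auto simp: consecutive_def\<close>)

text \<open>A component is recovered from the set of functionals that are positive on it, and there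
  are finitely many such sets. Finiteness matters because a sum over an infinite set is 0 by
  default.\<close>

lemma finite_components_off_bisectors:
  assumes "finite S"
  shows "finite (components (off_bisectors S))"
proof -
  define C where "C = {(a, c). consecutive S a c}"
  define sig where "sig z = {(a, c). consecutive S a c \<and> 0 < (c - a) \<bullet> z}" for z
  have "components (off_bisectors S) \<subseteq> (\<lambda>s. {w \<in> off_bisectors S. sig w = s}) ` Pow C"
  proof
    fix R assume "R \<in> components (off_bisectors S)"
    then obtain z where z: "z \<in> off_bisectors S" "R = connected_component_set (off_bisectors S) z"
      by (auto simp: components_def)
    have "R = {w \<in> off_bisectors S. sig w = sig z}"
      unfolding z(2) connected_component_off_bisectors[OF z(1)] sig_def by blast
    moreover have "sig z \<in> Pow C" by (auto simp: sig_def C_def)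
    ultimately show "R \<in> (\<lambda>s. {w \<in> off_bisectors S. sig w = s}) ` Pow C" by blast
  qed
  moreover have "finite ((\<lambda>s. {w \<in> off_bisectors S. sig w = s}) ` Pow C)"
    using finite_consecutive[OF assms] by (simp add: C_def)
  ultimately show ?thesis by (rule finite_subset)
qed

lemma Union_empty_regions:
  assumes S: "finite S" "S \<subseteq> sphere 0 1" "card S \<ge> 2"
  shows "\<Union> (empty_regions (card S) S) =
    {u \<in> off_bisectors S. \<forall>p\<in>S. \<forall>b\<in>S. \<not> (extremal S u p b \<and> extremal S p p b)}"
proof -
  have "u \<in> \<Union> (empty_regions (card S) S) \<longleftrightarrow>
      u \<in> off_bisectors S \<and> (connected_component_set (off_bisectors S) u) \<inter> S = {}" for u
  proof
    assume "u \<in> \<Union> (empty_regions (card S) S)"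
    then obtain R where R: "R \<in> components (off_bisectors S)" "R \<inter> S = {}" "u \<in> R"
      unfolding empty_regions_def regions_def off_bisectors[OF S(1,3,2)] by auto
    then show "u \<in> off_bisectors S \<and> (connected_component_set (off_bisectors S) u) \<inter> S = {}"
      unfolding components_def
      by (smt (verit) connected_component_eq connected_component_subset image_iff subsetD)
  next
    assume "u \<in> off_bisectors S \<and> (connected_component_set (off_bisectors S) u) \<inter> S = {}"
    then show "u \<in> \<Union> (empty_regions (card S) S)"
      unfolding empty_regions_def regions_def off_bisectors[OF S(1,3,2)]
      using componentsI connected_component_refl_eq by fastforce
  qed
  moreover have "p \<in> connected_component_set (off_bisectors S) u \<longleftrightarrow>
      (\<exists>b\<in>S. extremal S u p b \<and> extremal S p p b)" if "u \<in> off_bisectors S" "p \<in> S" for u p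
    unfolding connected_component_off_bisectors[OF that(1)] same_side_iff_extremal[OF S that(2)]
    using that(1) by (auto simp: off_bisectors_def)
  ultimately show ?thesis by blast
qed

text \<open>This places the cells of the pairs inside \<open>off_bisectors S\<close>, so that their
  measure can be subtracted.\<close>

lemma extremal_imp_off_bisectors:
  assumes "finite S" "S \<subseteq> sphere 0 1" "card S \<ge> 2" "p \<in> S" "b \<in> S" "extremal S u p b" "extremal S p p b"
  shows "u \<in> off_bisectors S"
  using same_side_iff_extremal[OF assms(1-4), of u] assms(5-7) by (auto simp: off_bisectors_def)

section \<open>Null sets on the circle and the total length of the empty regions\<close>

lemma sets_circle_measure [simp, measurable_cong]: "sets circle_measure = sets borel"
  by (simp add: circle_measure_def)

lemma space_circle_measure [simp]: "space circle_measure = UNIV"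
  by (simp add: circle_measure_def)

lemma borel_measurable_cis [measurable]: "cis \<in> borel_measurable borel"
  by (intro borel_measurable_continuous_onI continuous_intros)

lemma prob_space_circle_measure: "prob_space circle_measure"
  unfolding circle_measure_def
  by (intro prob_space.prob_space_distr prob_space_uniform_measure) auto

text \<open>On the circle the functional is a shifted cosine. Its zeros lie in an arithmetic
  progression, and a countable set of angles is null.\<close>

lemma line_null_sets:
  assumes "d \<noteq> 0"
  shows "{z. d \<bullet> z = 0} \<in> null_sets circle_measure"
proof -
  define \<phi> where "\<phi> = Arg d"
  have eq: "d \<bullet> cis t = norm d * cos (t - \<phi>)" for t
  proof -
    have "d = norm d *\<^sub>R cis \<phi>" using rcis_cmod_Arg[of d] by (simp add: \<phi>_def rcis_def scaleR_conv_of_real)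
    then have "d \<bullet> cis t = norm d * (cis \<phi> \<bullet> cis t)" by (metis inner_scaleR_left)
    then show ?thesis by (simp add: inner_complex_def cos_diff mult.commute)
  qed
  have "{t. d \<bullet> cis t = 0} \<subseteq> range (\<lambda>i::int. \<phi> + of_int i * (pi / 2))"
  proof
    fix t assume "t \<in> {t. d \<bullet> cis t = 0}"
    then have "cos (t - \<phi>) = 0" using assms by (simp add: eq)
    then obtain i :: int where "t - \<phi> = of_int i * (pi / 2)" by (auto simp: cos_zero_iff_int)
    then have "t = \<phi> + of_int i * (pi / 2)" by simp
    then show "t \<in> range (\<lambda>i::int. \<phi> + of_int i * (pi / 2))" by blast
  qed
  then have "countable {t. d \<bullet> cis t = 0}" by (rule countable_subset) simp
  then have "emeasure lborel {t. d \<bullet> cis t = 0} = 0" by (rule emeasure_lborel_countable)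
  moreover have "{t. d \<bullet> cis t = 0} \<in> sets borel" by measurable
  ultimately have "emeasure lborel ({0..<2 * pi} \<inter> {t. d \<bullet> cis t = 0}) = 0"
    by (metis Int_lower2 emeasure_eq_0 sets_lborel)
  moreover have "{z. d \<bullet> z = 0} \<in> sets borel" by measurable
  moreover have "cis -` {z. d \<bullet> z = 0} = {t. d \<bullet> cis t = 0}" by auto
  ultimately show ?thesis
    unfolding circle_measure_def
    by (intro null_setsI) (auto simp: emeasure_distr emeasure_uniform_measure \<open>{t. d \<bullet> cis t = 0} \<in> sets borel\<close>)
qed

lemma off_bisectors_null_sets:
  assumes "finite S" shows "- off_bisectors S \<in> null_sets circle_measure"
proof -
  have "- off_bisectors S = (\<Union>(a, c)\<in>{(a, c). consecutive S a c}. {z. (c - a) \<bullet> z = 0})"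
    by (auto simp: off_bisectors_def)
  also have "\<dots> \<in> null_sets circle_measure"
    using finite_consecutive[OF assms]
    by (intro null_sets_UN' countable_finite) (auto intro!: line_null_sets dest: consecutive_neq)
  finally show ?thesis .
qed

lemma open_off_bisectors:
  assumes "finite S" shows "open (off_bisectors S)"
proof -
  have "off_bisectors S = (\<Inter>(a, c)\<in>{(a, c). consecutive S a c}. - {z. (c - a) \<bullet> z = 0})"
    by (auto simp: off_bisectors_def)
  also have "open \<dots>"
    using finite_consecutive[OF assms] by (intro open_INT) (auto simp: closed_hyperplane)
  finally show ?thesis .
qed

lemma extremal_sets:
  assumes "finite S" shows "{u. extremal S u p b} \<in> sets borel"
proof -
  have "open (\<Inter>q\<in>S - {p}. {u. q \<bullet> u < p \<bullet> u})" "open (\<Inter>q\<in>S - {b}. {u. b \<bullet> u < q \<bullet> u})"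
    using assms by (auto intro!: open_INT open_Collect_less continuous_intros)
  moreover have "{u. extremal S u p b} = (\<Inter>q\<in>S - {p}. {u. q \<bullet> u < p \<bullet> u}) \<inter> (\<Inter>q\<in>S - {b}. {u. b \<bullet> u < q \<bullet> u})"
    by (auto simp: extremal_def)
  ultimately show ?thesis by simp
qed

text \<open>The empty regions form the complement of the bisectors, which has measure 1, minus the
  cells of the pairs \<open>(p, b)\<close>. The cells are disjoint because \<open>u\<close>
  determines its strict maximizer and its strict minimizer, so their measures add up.\<close>

lemma empty_length_eq:
  assumes S: "finite S" "S \<subseteq> sphere 0 1" "card S \<ge> 2"
  shows "empty_length (card S) S =
    1 - (\<Sum>p\<in>S. \<Sum>b\<in>S. measure circle_measure {u. extremal S u p b \<and> extremal S p p b})"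
proof -
  interpret prob_space circle_measure by (rule prob_space_circle_measure)
  define D where "D pb = {u. extremal S u (fst pb) (snd pb) \<and> extremal S (fst pb) (fst pb) (snd pb)}" for pb
  define E where "E = empty_regions (card S) S"
  have E: "E \<subseteq> components (off_bisectors S)"
    unfolding E_def empty_regions_def regions_def off_bisectors[OF S(1,3,2)] by auto
  have Eb: "R \<in> sets borel" if "R \<in> E" for R
    using E that open_components[OF open_off_bisectors[OF S(1)]] by auto
  have "finite E" using E finite_components_off_bisectors[OF S(1)] finite_subset by blast
  have Db: "D pb \<in> sets borel" for pb
    using extremal_sets[OF S(1)] by (cases "extremal S (fst pb) (fst pb) (snd pb)") (auto simp: D_def)
  have disj: "disjoint_family_on D (S \<times> S)"
  proof (unfold disjoint_family_on_def, intro ballI impI)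
    fix pb pb' assume pb: "pb \<in> S \<times> S" "pb' \<in> S \<times> S" "pb \<noteq> pb'"
    obtain p b p' b' where eq: "pb = (p, b)" "pb' = (p', b')" by fastforce
    have "False" if "extremal S u p b" "extremal S u p' b'" for u
    proof (cases "p = p'")
      case True
      then have "b \<bullet> u < b' \<bullet> u" "b' \<bullet> u < b \<bullet> u" using that pb eq by (auto simp: extremal_def)
      then show False by simp
    next
      case False
      then have "p \<bullet> u < p' \<bullet> u" "p' \<bullet> u < p \<bullet> u" using that pb eq by (auto simp: extremal_def)
      then show False by simp
    qed
    then show "D pb \<inter> D pb' = {}" by (auto simp: D_def eq)
  qed
  have Edisj: "disjoint_family_on (\<lambda>R. R) E"
    using E pairwise_disjoint_components[of "off_bisectors S"]
    unfolding disjoint_family_on_def pairwise_def disjnt_def by (meson subsetD)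
  have "empty_length (card S) S = (\<Sum>R\<in>E. prob R)"
    by (simp add: empty_length_def region_length_def E_def)
  also have "\<dots> = prob (\<Union>R\<in>E. R)"
    using \<open>finite E\<close> Eb Edisj by (intro finite_measure_finite_Union[symmetric]) auto
  also have "(\<Union>R\<in>E. R) = off_bisectors S - (\<Union>pb\<in>S \<times> S. D pb)"
    using Union_empty_regions[OF S] by (auto simp: E_def D_def)
  also have "prob \<dots> = prob (off_bisectors S) - prob (\<Union>pb\<in>S \<times> S. D pb)"
    using Db open_off_bisectors[OF S(1)] S(1) extremal_imp_off_bisectors[OF S]
    by (intro finite_measure_Diff) (auto intro!: sets.finite_UN simp: D_def)
  also have "prob (off_bisectors S) = 1"
    using prob_compl[of "- off_bisectors S"] off_bisectors_null_sets[OF S(1)] open_off_bisectors[OF S(1)]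
    by (simp add: Compl_eq_Diff_UNIV[symmetric] null_sets_def measure_def)
  also have "prob (\<Union>pb\<in>S \<times> S. D pb) = (\<Sum>pb\<in>S \<times> S. prob (D pb))"
    using disj S Db by (intro finite_measure_finite_Union) auto
  also have "\<dots> = (\<Sum>p\<in>S. \<Sum>b\<in>S. prob {u. extremal S u p b \<and> extremal S p p b})"
    by (simp add: sum.cartesian_product D_def case_prod_beta)
  finally show ?thesis .
qed

text \<open>
  Together with \<open>empty_length_eq\<close> this describes \<open>empty_length\<close> outside the almost sure event as well,
  which makes it measurable even when the underlying probability space is not complete.
\<close>
lemma empty_length_degenerate:
  assumes "S \<noteq> {}" "\<not> (S \<subseteq> sphere 0 1 \<and> card S = n)"
  shows "empty_length n S = 0"
proof -
  have "\<not> ccw_labelling n P S" for P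
  proof
    assume "ccw_labelling n P S"
    then obtain \<theta> :: "nat \<Rightarrow> real" where S: "P ` {..<n} = S"
      and 1: "\<forall>i j. i < j \<longrightarrow> j < n \<longrightarrow> \<theta> i < \<theta> j"
      and 2: "\<forall>i<n. P i = cis (\<theta> i) \<and> \<theta> i < \<theta> 0 + 2 * pi"
      by (rule labelling_angles)
    from 1 have mono: "\<theta> i < \<theta> j" if "i < j" "j < n" for i j using that by blast
    from 2 have P: "P i = cis (\<theta> i)" "\<theta> i < \<theta> 0 + 2 * pi" if "i < n" for i using that by blast+
    have lt: "P i \<noteq> P j" if "i < j" "j < n" for i j
    proof -
      have "\<theta> 0 \<le> \<theta> i" using mono[of 0 i] that by (cases "i = 0") auto
      then have "\<bar>\<theta> i - \<theta> j\<bar> < 2 * pi" using mono[OF that] P(2)[OF that(2)] by linarith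
      then show ?thesis using cis_eq_iff_near mono[OF that] P(1)[of i] P(1)[of j] that by auto
    qed
    have "inj_on P {..<n}"
      by (rule inj_onI) (metis lessThan_iff linorder_less_linear lt)
    then have "card S = n" using S card_image by fastforce
    moreover have "S \<subseteq> sphere 0 1" using S P(1) by auto
    ultimately show False using assms by blast
  qed
  then have "bisectors n S = {}" by (auto simp: bisectors_def)
  \<comment> \<open>Without bisectors the plane is the only region; it meets the nonempty set
    \<open>S\<close>, so the sum has no terms.\<close>
  then have "regions n S = {UNIV}" by (simp add: regions_def components_UNIV)
  then have "empty_regions n S = {}" using assms by (auto simp: empty_regions_def)
  then show ?thesis by (simp add: empty_length_def)
qed

section \<open>Integration over the circle\<close>

lemma nn_integral_circle_measure:
  assumes [measurable]: "h \<in> borel_measurable borel"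
  shows "(\<integral>\<^sup>+ z. h z \<partial>circle_measure) =
    (\<integral>\<^sup>+ x. h (cis (2 * pi * x)) * indicator {0..<1} x \<partial>lborel)"
proof -
  have "(\<integral>\<^sup>+ z. h z \<partial>circle_measure) =
      (\<integral>\<^sup>+ t. h (cis t) * indicator {0..<2 * pi} t \<partial>lborel) / ennreal (2 * pi)"
    unfolding circle_measure_def
    by (simp add: nn_integral_distr nn_integral_uniform_measure)
  also have "(\<integral>\<^sup>+ t. h (cis t) * indicator {0..<2 * pi} t \<partial>lborel) =
      ennreal (2 * pi) * (\<integral>\<^sup>+ x. h (cis (2 * pi * x)) * indicator {0..<2 * pi} (2 * pi * x) \<partial>lborel)"
    by (subst nn_integral_real_affine[where c = "2 * pi" and t = 0]) auto
  also have "(\<lambda>x. indicator {0..<2 * pi} (2 * pi * x)) = (indicator {0..<1} :: real \<Rightarrow> ennreal)"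
    by (auto simp: indicator_def fun_eq_iff zero_le_mult_iff not_le[THEN iffD2, OF pi_gt_zero])
  finally show ?thesis
    by (simp add: fun_eq_iff ennreal_mult_divide_eq mult.commute[of "ennreal (2 * pi)"])
qed

lemma nn_integral_periodic:
  assumes [measurable]: "g \<in> borel_measurable borel" and per: "\<And>x::real. g (x + 1) = g x"
  shows "(\<integral>\<^sup>+ x. g x * indicator {a..<a + 1} x \<partial>lborel) = (\<integral>\<^sup>+ x. g x * indicator {0..<1} x \<partial>lborel)"
proof -
  have step: "(\<integral>\<^sup>+ x. g x * indicator {c + 1..<d + 1} x \<partial>lborel) = (\<integral>\<^sup>+ x. g x * indicator {c..<d} x \<partial>lborel)" for c d
    by (subst nn_integral_real_affine[where c = 1 and t = 1])
      (auto simp: per add.commute[of 1] indicator_def intro!: nn_integral_cong)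
  have split: "(\<integral>\<^sup>+ x. g x * indicator {c..<e} x \<partial>lborel) =
      (\<integral>\<^sup>+ x. g x * indicator {c..<d} x \<partial>lborel) + (\<integral>\<^sup>+ x. g x * indicator {d..<e} x \<partial>lborel)"
    if "c \<le> d" "d \<le> e" for c d e
    by (subst nn_integral_add[symmetric]) (use that in \<open>auto simp: indicator_def intro!: nn_integral_cong\<close>)
  have frac: "(\<integral>\<^sup>+ x. g x * indicator {r..<r + 1} x \<partial>lborel) = (\<integral>\<^sup>+ x. g x * indicator {0..<1} x \<partial>lborel)"
    if "0 \<le> r" "r \<le> 1" for r
    using split[of r 1 "r + 1"] split[of 0 r 1] step[of 0 r] that by (simp add: add.commute)
  have ints: "(\<integral>\<^sup>+ x. g x * indicator {r + of_nat k..<r + of_nat k + 1} x \<partial>lborel) = (\<integral>\<^sup>+ x. g x * indicator {r..<r + 1} x \<partial>lborel)" for r k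
  proof (induction k)
    case (Suc k)
    have "r + of_nat (Suc k) = r + of_nat k + 1" by simp
    then show ?case by (simp only: step Suc)
  qed simp
  define k where "k = \<lfloor>a\<rfloor>"
  have k: "of_int k \<le> a" "a < of_int k + 1" unfolding k_def by linarith+
  define r where "r = a - of_int k"
  have r: "0 \<le> r" "r \<le> 1" using k by (auto simp: r_def)
  \<comment> \<open>\<open>ints\<close> shifts upwards by natural numbers only, so for negative
    \<open>k\<close> the shift leads from \<open>a\<close> to \<open>r\<close>.\<close>
  show ?thesis
  proof (cases "0 \<le> k")
    case True
    then have "a = r + of_nat (nat k)" by (simp add: r_def)
    then show ?thesis using ints[of r "nat k"] frac[OF r] by simp
  next
    case False
    then have "r = a + of_nat (nat (- k))" by (simp add: r_def)
    then show ?thesis using ints[of a "nat (- k)"] frac[OF r] by simp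
  qed
qed

lemma cis_2pi_period: "cis (2 * pi * (x + 1)) = cis (2 * pi * x)"
  by (simp add: distrib_left cis_mult[symmetric])

lemma nn_integral_circle_rotate:
  assumes [measurable]: "h \<in> borel_measurable borel" and p: "norm p = 1"
  shows "(\<integral>\<^sup>+ z. h (p * z) \<partial>circle_measure) = (\<integral>\<^sup>+ z. h z \<partial>circle_measure)"
proof -
  define a where "a = Arg p / (2 * pi)"
  have "p = cis (Arg p)" using rcis_cmod_Arg[of p] p by (simp add: rcis_def)
  then have "p = cis (2 * pi * a)" by (simp add: a_def)
  then have eq: "p * cis (2 * pi * x) = cis (2 * pi * (a + x))" for x
    by (simp add: cis_mult distrib_left)
  have "(\<integral>\<^sup>+ z. h (p * z) \<partial>circle_measure) =
      (\<integral>\<^sup>+ x. h (cis (2 * pi * (a + x))) * indicator {a..<a + 1} (a + x) \<partial>lborel)"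
    by (subst nn_integral_circle_measure) (auto simp: eq indicator_def intro!: nn_integral_cong)
  also have "\<dots> = (\<integral>\<^sup>+ x. h (cis (2 * pi * x)) * indicator {a..<a + 1} x \<partial>lborel)"
    by (subst (2) nn_integral_real_affine[where c = 1 and t = a]) auto
  also have "\<dots> = (\<integral>\<^sup>+ z. h z \<partial>circle_measure)"
    by (subst nn_integral_periodic) (auto simp: cis_2pi_period nn_integral_circle_measure)
  finally show ?thesis .
qed

lemma nn_integral_circle_cnj:
  assumes [measurable]: "h \<in> borel_measurable borel"
  shows "(\<integral>\<^sup>+ z. h (cnj z) \<partial>circle_measure) = (\<integral>\<^sup>+ z. h z \<partial>circle_measure)"
proof -
  have [measurable]: "cnj \<in> borel_measurable borel"
    by (intro borel_measurable_continuous_onI continuous_intros)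
  have "(\<integral>\<^sup>+ z. h (cnj z) \<partial>circle_measure) = (\<integral>\<^sup>+ x. h (cis (2 * pi * (0 + (- 1) * x))) * indicator {- 1<..0} (0 + (- 1) * x) \<partial>lborel)"
    by (subst nn_integral_circle_measure) (auto simp: cis_cnj indicator_def intro!: nn_integral_cong)
  also have "\<dots> = (\<integral>\<^sup>+ x. h (cis (2 * pi * x)) * indicator {- 1<..0} x \<partial>lborel)"
    by (subst (2) nn_integral_real_affine[where c = "- 1" and t = 0]) auto
  \<comment> \<open>Reflection produces a window closed on the right; it differs from the half-open
    one required below in its end points only.\<close>
  also have "\<dots> = (\<integral>\<^sup>+ x. h (cis (2 * pi * x)) * indicator {- 1..<- 1 + 1} x \<partial>lborel)"
    by (rule nn_integral_cong_AE, use AE_lborel_singleton[of 0] AE_lborel_singleton[of "- 1"] in eventually_elim)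
      (auto simp: indicator_def)
  also have "\<dots> = (\<integral>\<^sup>+ z. h z \<partial>circle_measure)"
    by (subst nn_integral_periodic) (auto simp: cis_2pi_period nn_integral_circle_measure)
  finally show ?thesis .
qed

lemma AE_circle_norm: "AE z in circle_measure. norm z = 1"
  unfolding circle_measure_def by (subst AE_distr_iff) auto

lemma AE_circle_neq: "AE z in circle_measure. z \<noteq> w"
proof -
  \<comment> \<open>A quarter turn of \<open>w\<close> is normal to the line through
    \<open>0\<close> and \<open>w\<close>, so the single point \<open>w\<close> lies in a null
    set.\<close>
  define d where "d = (if w = 0 then 1 else \<i> * w)"
  have "d \<noteq> 0" "d \<bullet> w = 0" by (auto simp: d_def inner_complex_def)
  then show ?thesis
    by (intro AE_I'[OF line_null_sets[of d]]) auto
qed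

section \<open>Reduction to an integral over three points\<close>

interpretation circle: prob_space circle_measure by (rule prob_space_circle_measure)
interpretation circle_prod: product_sigma_finite "\<lambda>_::nat. circle_measure" ..

text \<open>The function \<open>F\<close> of the overview, written as an integral so that
  measurability in all three arguments comes from Fubini.\<close>

definition cell_measure :: "complex \<Rightarrow> complex \<Rightarrow> complex \<Rightarrow> ennreal" where
  "cell_measure p b u = (\<integral>\<^sup>+ q. (if q \<bullet> u < p \<bullet> u \<and> b \<bullet> u < q \<bullet> u \<and> q \<bullet> p < p \<bullet> p \<and> b \<bullet> p < q \<bullet> p
     then 1 else 0) \<partial>circle_measure)"

text \<open>The inequalities between \<open>p\<close> and \<open>b\<close> themselves are split off,
  which leaves one equal factor for each of the \<open>m\<close> further points.\<close>

definition pair_weight :: "nat \<Rightarrow> complex \<Rightarrow> complex \<Rightarrow> complex \<Rightarrow> ennreal" where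
  "pair_weight m p b u = (if b \<bullet> u < p \<bullet> u \<and> b \<bullet> p < p \<bullet> p then cell_measure p b u ^ m else 0)"

lemma borel_measurable_cell_measure [measurable (raw)]:
  assumes [measurable]: "f \<in> borel_measurable M" "g \<in> borel_measurable M" "h \<in> borel_measurable M"
  shows "(\<lambda>x. cell_measure (f x) (g x) (h x)) \<in> borel_measurable M"
  unfolding cell_measure_def by measurable

lemma borel_measurable_pair_weight [measurable (raw)]:
  assumes [measurable]: "f \<in> borel_measurable M" "g \<in> borel_measurable M" "h \<in> borel_measurable M"
  shows "(\<lambda>x. pair_weight m (f x) (g x) (h x)) \<in> borel_measurable M"
  unfolding pair_weight_def by measurable

lemma nn_integral_PiM_insert2:
  fixes i j :: nat
  assumes K: "finite K" "i \<notin> K" "j \<notin> K" "i \<noteq> j"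
    and f: "f \<in> borel_measurable (Pi\<^sub>M (insert i (insert j K)) (\<lambda>_. circle_measure))"
  shows "(\<integral>\<^sup>+ x. f x \<partial>Pi\<^sub>M (insert i (insert j K)) (\<lambda>_. circle_measure)) =
    (\<integral>\<^sup>+ p. \<integral>\<^sup>+ b. \<integral>\<^sup>+ x. f (x(j := b, i := p)) \<partial>Pi\<^sub>M K (\<lambda>_. circle_measure) \<partial>circle_measure \<partial>circle_measure)"
proof -
  have "(\<lambda>x. f (x(i := p))) \<in> borel_measurable (Pi\<^sub>M (insert j K) (\<lambda>_. circle_measure))" for p
    by (rule measurable_compose[OF measurable_fun_upd f]) auto
  then have "(\<integral>\<^sup>+ x. f (x(i := p)) \<partial>Pi\<^sub>M (insert j K) (\<lambda>_. circle_measure)) =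
      (\<integral>\<^sup>+ b. \<integral>\<^sup>+ x. f (x(j := b, i := p)) \<partial>Pi\<^sub>M K (\<lambda>_. circle_measure) \<partial>circle_measure)" for p
    using K by (subst circle_prod.product_nn_integral_insert_rev) auto
  then show ?thesis
    using K f by (subst circle_prod.product_nn_integral_insert_rev) auto
qed

text \<open>Both extremality conditions in terms of indices. Unlike sums over the random set of
  points, sums over indices have a fixed range, and each condition is measurable in the
  coordinates.\<close>

definition extremal_at :: "nat \<Rightarrow> nat \<Rightarrow> nat \<Rightarrow> (nat \<Rightarrow> complex) \<Rightarrow> complex \<Rightarrow> bool" where
  "extremal_at n i j x u \<longleftrightarrow>
     (\<forall>k<n. k \<noteq> i \<longrightarrow> x k \<bullet> u < x i \<bullet> u \<and> x k \<bullet> x i < x i \<bullet> x i) \<and>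
     (\<forall>k<n. k \<noteq> j \<longrightarrow> x j \<bullet> u < x k \<bullet> u \<and> x j \<bullet> x i < x k \<bullet> x i)"

lemma extremal_at_iff:
  assumes "inj_on x {..<n}" "i < n" "j < n"
  shows "extremal_at n i j x u \<longleftrightarrow>
    extremal (x ` {..<n}) u (x i) (x j) \<and> extremal (x ` {..<n}) (x i) (x i) (x j)"
proof -
  have "x k \<noteq> x i \<longleftrightarrow> k \<noteq> i" "x k \<noteq> x j \<longleftrightarrow> k \<noteq> j" if "k < n" for k
    using assms that by (auto simp: inj_on_eq_iff)
  then show ?thesis by (auto simp: extremal_at_def extremal_def)
qed

lemma borel_measurable_circle_component:
  assumes "k < n"
  shows "(\<lambda>x. x k) \<in> borel_measurable (Pi\<^sub>M {..<n} (\<lambda>_. circle_measure))"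
proof -
  have "(\<lambda>x. x k) \<in> measurable (Pi\<^sub>M {..<n} (\<lambda>_. circle_measure)) circle_measure"
    using assms by (intro measurable_component_singleton) simp
  then show ?thesis using measurable_cong_sets[OF refl sets_circle_measure] by blast
qed

lemma pred_extremal_at:
  assumes "i < n" "j < n"
  shows "Measurable.pred (Pi\<^sub>M {..<n} (\<lambda>_. circle_measure) \<Otimes>\<^sub>M circle_measure)
    (\<lambda>w. extremal_at n i j (fst w) (snd w))"
proof -
  have *: "(\<lambda>w. fst w k) \<in> borel_measurable (Pi\<^sub>M {..<n} (\<lambda>_. circle_measure) \<Otimes>\<^sub>M circle_measure)" if "k < n" for k
    by (rule measurable_compose[OF measurable_fst borel_measurable_circle_component[OF that]])
  note [measurable] = * *[OF assms(1)] *[OF assms(2)]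
  show ?thesis unfolding extremal_at_def by measurable
qed

text \<open>For fixed \<open>x i\<close>, \<open>x j\<close> and \<open>u\<close> the indicator is a
  product with one factor per remaining coordinate, so its integral is a power. To use this, Fubini
  first moves the integral over \<open>u\<close> outside of those coordinates.\<close>

lemma nn_integral_extremal_at:
  assumes ij: "i < n" "j < n" "i \<noteq> j"
  shows "(\<integral>\<^sup>+ x. emeasure circle_measure {u. extremal_at n i j x u} \<partial>Pi\<^sub>M {..<n} (\<lambda>_. circle_measure)) =
    (\<integral>\<^sup>+ p. \<integral>\<^sup>+ b. \<integral>\<^sup>+ u. pair_weight (n - 2) p b u \<partial>circle_measure \<partial>circle_measure \<partial>circle_measure)"
proof -
  define K where "K = {..<n} - {i, j}"
  have K: "finite K" "i \<notin> K" "j \<notin> K" "insert i (insert j K) = {..<n}" "card K = n - 2"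
    using ij by (auto simp: K_def card_Diff_subset)
  let ?P = "\<lambda>I. Pi\<^sub>M I (\<lambda>_::nat. circle_measure)"
  let ?g = "\<lambda>x u. if extremal_at n i j x u then 1 else 0 :: ennreal"
  note [measurable] = pred_extremal_at[OF ij(1,2)]
  have em: "emeasure circle_measure {u. extremal_at n i j x u} = (\<integral>\<^sup>+ u. ?g x u \<partial>circle_measure)"
    if "x \<in> space (?P {..<n})" for x
  proof -
    have "(\<lambda>u. (x, u)) \<in> measurable circle_measure (?P {..<n} \<Otimes>\<^sub>M circle_measure)"
      using that by simp
    from measurable_compose[OF this pred_extremal_at[OF ij(1,2)]]
    have "Measurable.pred circle_measure (extremal_at n i j x)" by simp
    then have "{u. extremal_at n i j x u} \<in> sets circle_measure" by (simp add: pred_def)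
    then have "emeasure circle_measure {u. extremal_at n i j x u} =
        (\<integral>\<^sup>+ u. indicator {u. extremal_at n i j x u} u \<partial>circle_measure)" by simp
    then show ?thesis by (simp add: indicator_def of_bool_def)
  qed
  have "sigma_finite_measure (?P K)" by (rule circle_prod.sigma_finite) (rule K(1))
  then have pair: "pair_sigma_finite (?P K) circle_measure"
    by (rule pair_sigma_finite.intro) (rule circle.sigma_finite_measure_axioms)
  have inner: "(\<integral>\<^sup>+ x. \<integral>\<^sup>+ u. ?g (x(j := b, i := p)) u \<partial>circle_measure \<partial>?P K) =
      (\<integral>\<^sup>+ u. pair_weight (n - 2) p b u \<partial>circle_measure)" for p b
  proof -
    have "(\<lambda>w. (fst w)(j := b)) \<in> measurable (?P K \<Otimes>\<^sub>M circle_measure) (?P (insert j K))"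
      by (rule measurable_fun_upd[where J = K]) auto
    then have "(\<lambda>w. (fst w)(j := b, i := p)) \<in> measurable (?P K \<Otimes>\<^sub>M circle_measure) (?P {..<n})"
      by (rule measurable_fun_upd[rotated, where J = "insert j K"]) (use K in auto)
    then have upd: "(\<lambda>w. ((fst w)(j := b, i := p), snd w)) \<in> measurable (?P K \<Otimes>\<^sub>M circle_measure) (?P {..<n} \<Otimes>\<^sub>M circle_measure)"
      by (rule measurable_Pair) (rule measurable_snd)
    have "(\<lambda>w. ?g ((fst w)(j := b, i := p)) (snd w)) \<in> borel_measurable (?P K \<Otimes>\<^sub>M circle_measure)"
      using measurable_compose[OF upd pred_extremal_at[OF ij(1,2)]] by simp
    then have "(\<integral>\<^sup>+ x. \<integral>\<^sup>+ u. ?g (x(j := b, i := p)) u \<partial>circle_measure \<partial>?P K) =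
        (\<integral>\<^sup>+ u. \<integral>\<^sup>+ x. ?g (x(j := b, i := p)) u \<partial>?P K \<partial>circle_measure)"
      by (intro pair_sigma_finite.Fubini'[OF pair, symmetric]) (simp add: case_prod_beta)
    also have "\<dots> = (\<integral>\<^sup>+ u. pair_weight (n - 2) p b u \<partial>circle_measure)"
    proof (rule nn_integral_cong)
      fix u
      define c where "c q = (if q \<bullet> u < p \<bullet> u \<and> b \<bullet> u < q \<bullet> u \<and> q \<bullet> p < p \<bullet> p \<and> b \<bullet> p < q \<bullet> p then 1 else 0 :: ennreal)" for q
      have [measurable]: "c \<in> borel_measurable borel" unfolding c_def by measurable
      have prod: "(\<Prod>k\<in>K. c (x k)) = (if \<forall>k\<in>K. c (x k) = 1 then 1 else 0)" for x
      proof (cases "\<forall>k\<in>K. c (x k) = 1")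
        case False
        then obtain k where k: "k \<in> K" "c (x k) \<noteq> 1" by blast
        then have "c (x k) = 0" unfolding c_def by presburger
        then have "(\<Prod>k\<in>K. c (x k)) = 0" using k(1) K(1) by (intro prod_zero) blast+
        then show ?thesis using False by simp
      qed simp
      have "extremal_at n i j (x(j := b, i := p)) u \<longleftrightarrow>
          (b \<bullet> u < p \<bullet> u \<and> b \<bullet> p < p \<bullet> p) \<and> (\<forall>k\<in>K. c (x k) = 1)" for x
        using ij unfolding extremal_at_def c_def K_def by (auto split: if_splits)
      then have "?g (x(j := b, i := p)) u = (if b \<bullet> u < p \<bullet> u \<and> b \<bullet> p < p \<bullet> p then \<Prod>k\<in>K. c (x k) else 0)" for x
        by (auto simp: prod)
      then have "(\<integral>\<^sup>+ x. ?g (x(j := b, i := p)) u \<partial>?P K) =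
          (if b \<bullet> u < p \<bullet> u \<and> b \<bullet> p < p \<bullet> p then \<integral>\<^sup>+ x. (\<Prod>k\<in>K. c (x k)) \<partial>?P K else 0)"
        by (cases "b \<bullet> u < p \<bullet> u"; cases "b \<bullet> p < p \<bullet> p"; simp)
      also have "(\<integral>\<^sup>+ x. (\<Prod>k\<in>K. c (x k)) \<partial>?P K) = (\<Prod>k\<in>K. \<integral>\<^sup>+ q. c q \<partial>circle_measure)"
        using K(1) by (intro circle_prod.product_nn_integral_prod) auto
      also have "\<dots> = cell_measure p b u ^ (n - 2)"
        by (simp add: cell_measure_def c_def K(5))
      finally show "(\<integral>\<^sup>+ x. ?g (x(j := b, i := p)) u \<partial>?P K) = pair_weight (n - 2) p b u"
        unfolding pair_weight_def .
    qed
    finally show ?thesis .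
  qed
  have meas: "(\<lambda>x. \<integral>\<^sup>+ u. ?g x u \<partial>circle_measure) \<in> borel_measurable (?P {..<n})"
    by (rule circle.borel_measurable_nn_integral) (use pred_extremal_at[OF ij(1,2)] in \<open>simp add: case_prod_beta\<close>)
  have "(\<integral>\<^sup>+ x. emeasure circle_measure {u. extremal_at n i j x u} \<partial>?P {..<n}) =
      (\<integral>\<^sup>+ x. \<integral>\<^sup>+ u. ?g x u \<partial>circle_measure \<partial>?P {..<n})"
    by (rule nn_integral_cong) (rule em)
  also have "\<dots> = (\<integral>\<^sup>+ p. \<integral>\<^sup>+ b. \<integral>\<^sup>+ x. \<integral>\<^sup>+ u. ?g (x(j := b, i := p)) u \<partial>circle_measure \<partial>?P K \<partial>circle_measure \<partial>circle_measure)"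
    using nn_integral_PiM_insert2[OF K(1-3) ij(3), of "\<lambda>x. \<integral>\<^sup>+ u. ?g x u \<partial>circle_measure"] meas
    unfolding K(4) by simp
  also have "\<dots> = (\<integral>\<^sup>+ p. \<integral>\<^sup>+ b. \<integral>\<^sup>+ u. pair_weight (n - 2) p b u \<partial>circle_measure \<partial>circle_measure \<partial>circle_measure)"
    by (simp only: inner)
  finally show ?thesis .
qed

section \<open>Evaluation of the integral\<close>

text \<open>
  The measure of the admissible positions of a further point when \<open>p = 1\<close>, \<open>b = cis (2 * pi * b')\<close> and
  \<open>u = cis (pi * s)\<close>, with \<open>b'\<close> the argument called \<open>b\<close> here. Beware that \<open>u\<close> is parametrized by twice
  its fraction of the circle.
\<close>
definition cell_length :: "real \<Rightarrow> real \<Rightarrow> real" where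
  "cell_length b s = max 0 (min b (1 - b) - s) + (1 - max b (1 + s - b))"

lemma borel_measurable_cell_length [measurable (raw)]:
  assumes [measurable]: "f \<in> borel_measurable M" "g \<in> borel_measurable M"
  shows "(\<lambda>x. cell_length (f x) (g x)) \<in> borel_measurable M"
  unfolding cell_length_def by measurable

section \<open>Iterated integral of the powers of \<open>cell_length\<close>\<close>

lemma nn_integral_Icc_cong:
  assumes "\<And>x::real. a \<le> x \<Longrightarrow> x \<le> b \<Longrightarrow> f x = g x"
  shows "(\<integral>\<^sup>+ x. f x * indicator {a..b} x \<partial>lborel) = (\<integral>\<^sup>+ x. g x * indicator {a..b} x \<partial>lborel)"
  by (rule nn_integral_cong) (use assms in \<open>auto simp: indicator_def\<close>)

lemma nn_integral_Icc_split:
  fixes a b c :: real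
  assumes [measurable]: "f \<in> borel_measurable borel" and "a \<le> c" "c \<le> b"
  shows "(\<integral>\<^sup>+ x. f x * indicator {a..b} x \<partial>lborel) =
    (\<integral>\<^sup>+ x. f x * indicator {a..c} x \<partial>lborel) + (\<integral>\<^sup>+ x. f x * indicator {c..b} x \<partial>lborel)"
  by (subst nn_integral_add[symmetric], simp, simp, rule nn_integral_cong_AE,
      use AE_lborel_singleton[of c] in eventually_elim)
    (use assms in \<open>auto simp: indicator_def\<close>)

lemma nn_integral_power_Icc:
  fixes c :: real
  assumes ab: "a \<le> b" and c: "c \<noteq> 0" and nn: "\<And>x. a \<le> x \<Longrightarrow> x \<le> b \<Longrightarrow> 0 \<le> c * x + d"
  shows "(\<integral>\<^sup>+ x. ennreal ((c * x + d) ^ m) * indicator {a..b} x \<partial>lborel) =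
    ennreal (((c * b + d) ^ Suc m - (c * a + d) ^ Suc m) / (c * real (Suc m)))"
proof -
  have "(\<integral>\<^sup>+ x. ennreal ((c * x + d) ^ m) * indicator {a..b} x \<partial>lborel) =
    ennreal ((c * b + d) ^ Suc m / (c * real (Suc m)) - (c * a + d) ^ Suc m / (c * real (Suc m)))"
  proof (rule nn_integral_FTC_Icc)
    show "((\<lambda>x. (c * x + d) ^ Suc m / (c * real (Suc m))) has_real_derivative (c * x + d) ^ m) (at x)" for x
      by (rule derivative_eq_intros refl | use c in \<open>simp add: field_simps del: of_nat_Suc power_Suc\<close>)+
  qed (use ab nn in auto)
  then show ?thesis by (simp add: diff_divide_distrib)
qed

lemma DERIV_affine_power:
  fixes c :: real
  assumes "\<And>x. f x = c * x + d"
  shows "((\<lambda>x. f x ^ Suc k) has_real_derivative real (Suc k) * c * f x ^ k) (at x)"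
proof -
  have "f = (\<lambda>x. c * x + d)" using assms by auto
  then show ?thesis
    by (auto intro!: derivative_eq_intros simp del: power_Suc)
qed

text \<open>For \<open>b \<le> 1 / 2\<close> both admissible arcs have length
  \<open>b - s\<close>.\<close>

lemma cell_length_integral_low:
  assumes "0 \<le> b" "b \<le> 1 / 2"
  shows "(\<integral>\<^sup>+ s. ennreal (cell_length b s ^ m) * indicator {0..b} s \<partial>lborel) =
    ennreal ((2 * b) ^ Suc m / (2 * real (Suc m)))"
proof -
  have "(\<integral>\<^sup>+ s. ennreal (cell_length b s ^ m) * indicator {0..b} s \<partial>lborel) =
      (\<integral>\<^sup>+ s. ennreal ((- 2 * s + 2 * b) ^ m) * indicator {0..b} s \<partial>lborel)"
    by (rule nn_integral_Icc_cong, rule arg_cong[where f = "\<lambda>x. ennreal (x ^ m)"])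
      (use assms in \<open>auto simp: cell_length_def max_def min_def\<close>)
  also have "\<dots> = ennreal (((- 2 * b + 2 * b) ^ Suc m - (- 2 * 0 + 2 * b) ^ Suc m) / (- 2 * real (Suc m)))"
    using assms by (intro nn_integral_power_Icc) auto
  also have "((- 2 * b + 2 * b) ^ Suc m - (- 2 * 0 + 2 * b) ^ Suc m) / (- 2 * real (Suc m)) =
      (2 * b) ^ Suc m / (2 * real (Suc m))"
    by (simp add: field_simps del: of_nat_Suc)
  finally show ?thesis .
qed

text \<open>The second arc changes its formula at \<open>s = 2 * b - 1\<close> and the first one
  vanishes from \<open>s = 1 - b\<close> on. These breakpoints come in this order exactly up to
  \<open>b = 2 / 3\<close>; the pieces are \<open>2 - 2 * b - s\<close>, \<open>1 - 2 * s\<close>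
  and \<open>b - s\<close>.\<close>

lemma cell_length_integral_mid:
  assumes "1 / 2 \<le> b" "b \<le> 2 / 3"
  shows "(\<integral>\<^sup>+ s. ennreal (cell_length b s ^ m) * indicator {0..b} s \<partial>lborel) =
    ennreal (((2 * b - 1) ^ Suc m / 2 - (3 - 4 * b) ^ Suc m / 2 + (2 - 2 * b) ^ Suc m) / real (Suc m))"
proof -
  let ?I = "\<lambda>x y. \<integral>\<^sup>+ s. ennreal (cell_length b s ^ m) * indicator {x..y} s \<partial>lborel"
  let ?M = "real (Suc m)"
  have "?I 0 (2 * b - 1) = (\<integral>\<^sup>+ s. ennreal ((- 1 * s + (2 - 2 * b)) ^ m) * indicator {0..2 * b - 1} s \<partial>lborel)"
    by (rule nn_integral_Icc_cong, rule arg_cong[where f = "\<lambda>x. ennreal (x ^ m)"])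
      (use assms in \<open>auto simp: cell_length_def max_def min_def\<close>)
  also have "\<dots> = ennreal (((- 1 * (2 * b - 1) + (2 - 2 * b)) ^ Suc m - (- 1 * 0 + (2 - 2 * b)) ^ Suc m) / (- 1 * ?M))"
    using assms by (intro nn_integral_power_Icc) auto
  also have "\<dots> = ennreal (((2 - 2 * b) ^ Suc m - (3 - 4 * b) ^ Suc m) / ?M)"
    by (rule arg_cong[where f = ennreal]) (simp add: minus_divide_left algebra_simps del: of_nat_Suc power_Suc)
  finally have 1: "?I 0 (2 * b - 1) = \<dots>" .
  have "?I (2 * b - 1) (1 - b) = (\<integral>\<^sup>+ s. ennreal ((- 2 * s + 1) ^ m) * indicator {2 * b - 1..1 - b} s \<partial>lborel)"
    by (rule nn_integral_Icc_cong, rule arg_cong[where f = "\<lambda>x. ennreal (x ^ m)"])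
      (use assms in \<open>auto simp: cell_length_def max_def min_def\<close>)
  also have "\<dots> = ennreal (((- 2 * (1 - b) + 1) ^ Suc m - (- 2 * (2 * b - 1) + 1) ^ Suc m) / (- 2 * ?M))"
    using assms by (intro nn_integral_power_Icc) auto
  also have "\<dots> = ennreal (((3 - 4 * b) ^ Suc m - (2 * b - 1) ^ Suc m) / (2 * ?M))"
    by (rule arg_cong[where f = ennreal]) (simp add: minus_divide_left algebra_simps del: of_nat_Suc power_Suc)
  finally have 2: "?I (2 * b - 1) (1 - b) = \<dots>" .
  have "?I (1 - b) b = (\<integral>\<^sup>+ s. ennreal ((- 1 * s + b) ^ m) * indicator {1 - b..b} s \<partial>lborel)"
    by (rule nn_integral_Icc_cong, rule arg_cong[where f = "\<lambda>x. ennreal (x ^ m)"])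
      (use assms in \<open>auto simp: cell_length_def max_def min_def\<close>)
  also have "\<dots> = ennreal (((- 1 * b + b) ^ Suc m - (- 1 * (1 - b) + b) ^ Suc m) / (- 1 * ?M))"
    using assms by (intro nn_integral_power_Icc) auto
  also have "\<dots> = ennreal ((2 * b - 1) ^ Suc m / ?M)"
    by (rule arg_cong[where f = ennreal]) (simp add: minus_divide_left algebra_simps del: of_nat_Suc)
  finally have 3: "?I (1 - b) b = \<dots>" .
  have le: "(3 - 4 * b) ^ Suc m \<le> (2 - 2 * b) ^ Suc m" "(2 * b - 1) ^ Suc m \<le> (3 - 4 * b) ^ Suc m"
      "0 \<le> (2 * b - 1) ^ Suc m"
    using assms by (auto intro!: power_mono simp del: power_Suc)
  have "?I 0 b = ?I 0 (2 * b - 1) + (?I (2 * b - 1) (1 - b) + ?I (1 - b) b)"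
    using assms nn_integral_Icc_split[of "\<lambda>s. ennreal (cell_length b s ^ m)" 0 "2 * b - 1" b]
      nn_integral_Icc_split[of "\<lambda>s. ennreal (cell_length b s ^ m)" "2 * b - 1" "1 - b" b] by simp
  also have "\<dots> = ennreal (((2 - 2 * b) ^ Suc m - (3 - 4 * b) ^ Suc m) / ?M +
      (((3 - 4 * b) ^ Suc m - (2 * b - 1) ^ Suc m) / (2 * ?M) + (2 * b - 1) ^ Suc m / ?M))"
    unfolding 1 2 3 using le by (simp add: ennreal_plus[symmetric] del: ennreal_plus power_Suc of_nat_Suc)
  also have "\<dots> = ennreal (((2 * b - 1) ^ Suc m / 2 - (3 - 4 * b) ^ Suc m / 2 + (2 - 2 * b) ^ Suc m) / ?M)"
    by (rule arg_cong[where f = ennreal]) (simp add: field_simps del: power_Suc of_nat_Suc)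
  finally show ?thesis .
qed

text \<open>Now the breakpoint \<open>1 - b\<close> comes first. Between the two breakpoints the
  first arc is gone while the second still has the constant length \<open>1 - b\<close>, so this
  piece is integrated as a constant.\<close>

lemma cell_length_integral_high:
  assumes "2 / 3 \<le> b" "b \<le> 1"
  shows "(\<integral>\<^sup>+ s. ennreal (cell_length b s ^ m) * indicator {0..b} s \<partial>lborel) =
    ennreal ((3 * b - 2) * (1 - b) ^ m + (2 - 2 * b) ^ Suc m / real (Suc m))"
proof -
  let ?I = "\<lambda>x y. \<integral>\<^sup>+ s. ennreal (cell_length b s ^ m) * indicator {x..y} s \<partial>lborel"
  let ?M = "real (Suc m)"
  have "?I 0 (1 - b) = (\<integral>\<^sup>+ s. ennreal ((- 1 * s + (2 - 2 * b)) ^ m) * indicator {0..1 - b} s \<partial>lborel)"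
    by (rule nn_integral_Icc_cong, rule arg_cong[where f = "\<lambda>x. ennreal (x ^ m)"])
      (use assms in \<open>auto simp: cell_length_def max_def min_def\<close>)
  also have "\<dots> = ennreal (((- 1 * (1 - b) + (2 - 2 * b)) ^ Suc m - (- 1 * 0 + (2 - 2 * b)) ^ Suc m) / (- 1 * ?M))"
    using assms by (intro nn_integral_power_Icc) auto
  also have "\<dots> = ennreal (((2 - 2 * b) ^ Suc m - (1 - b) ^ Suc m) / ?M)"
    by (rule arg_cong[where f = ennreal]) (simp add: minus_divide_left algebra_simps del: of_nat_Suc power_Suc)
  finally have 1: "?I 0 (1 - b) = \<dots>" .
  have "?I (1 - b) (2 * b - 1) = (\<integral>\<^sup>+ s. ennreal ((1 - b) ^ m) * indicator {1 - b..2 * b - 1} s \<partial>lborel)"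
    by (rule nn_integral_Icc_cong, rule arg_cong[where f = "\<lambda>x. ennreal (x ^ m)"])
      (use assms in \<open>auto simp: cell_length_def max_def min_def\<close>)
  also have "\<dots> = ennreal ((3 * b - 2) * (1 - b) ^ m)"
    using assms by (subst nn_integral_cmult_indicator) (auto simp: ennreal_mult'[symmetric] mult.commute)
  finally have 2: "?I (1 - b) (2 * b - 1) = \<dots>" .
  have "?I (2 * b - 1) b = (\<integral>\<^sup>+ s. ennreal ((- 1 * s + b) ^ m) * indicator {2 * b - 1..b} s \<partial>lborel)"
    by (rule nn_integral_Icc_cong, rule arg_cong[where f = "\<lambda>x. ennreal (x ^ m)"])
      (use assms in \<open>auto simp: cell_length_def max_def min_def\<close>)
  also have "\<dots> = ennreal (((- 1 * b + b) ^ Suc m - (- 1 * (2 * b - 1) + b) ^ Suc m) / (- 1 * ?M))"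
    using assms by (intro nn_integral_power_Icc) auto
  also have "\<dots> = ennreal ((1 - b) ^ Suc m / ?M)"
    by (rule arg_cong[where f = ennreal]) (simp add: minus_divide_left algebra_simps del: of_nat_Suc)
  finally have 3: "?I (2 * b - 1) b = \<dots>" .
  have le: "(1 - b) ^ Suc m \<le> (2 - 2 * b) ^ Suc m" "0 \<le> (1 - b) ^ Suc m" "0 \<le> (3 * b - 2) * (1 - b) ^ m"
    using assms by (auto intro!: power_mono simp del: power_Suc)
  have "?I 0 b = ?I 0 (1 - b) + (?I (1 - b) (2 * b - 1) + ?I (2 * b - 1) b)"
    using assms nn_integral_Icc_split[of "\<lambda>s. ennreal (cell_length b s ^ m)" 0 "1 - b" b]
      nn_integral_Icc_split[of "\<lambda>s. ennreal (cell_length b s ^ m)" "1 - b" "2 * b - 1" b] by simp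
  also have "\<dots> = ennreal (((2 - 2 * b) ^ Suc m - (1 - b) ^ Suc m) / ?M +
      ((3 * b - 2) * (1 - b) ^ m + (1 - b) ^ Suc m / ?M))"
    unfolding 1 2 3 using le by (simp add: ennreal_plus[symmetric] del: ennreal_plus power_Suc of_nat_Suc)
  also have "\<dots> = ennreal ((3 * b - 2) * (1 - b) ^ m + (2 - 2 * b) ^ Suc m / ?M)"
    by (rule arg_cong[where f = ennreal]) (simp add: field_simps del: power_Suc of_nat_Suc)
  finally show ?thesis .
qed

lemma cell_length_integral:
  "(\<integral>\<^sup>+ b. (\<integral>\<^sup>+ s. ennreal (cell_length b s ^ m) * indicator {0..b} s \<partial>lborel) * indicator {0..1} b \<partial>lborel) =
    ennreal ((5 / 8 + 3 / (8 * 3 ^ m)) / (real (Suc m) * real (Suc (Suc m))))"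
proof -
  let ?J = "\<lambda>b. \<integral>\<^sup>+ s. ennreal (cell_length b s ^ m) * indicator {0..b} s \<partial>lborel"
  let ?I = "\<lambda>x y. \<integral>\<^sup>+ b. ?J b * indicator {x..y} b \<partial>lborel"
  define M N where "M = real (Suc m)" and "N = real (Suc (Suc m))"
  \<comment> \<open>At \<open>b = 2 / 3\<close> the bases \<open>2 * b - 1\<close>,
    \<open>3 - 4 * b\<close> and \<open>1 - b\<close> all equal \<open>1 / 3\<close>, and
    \<open>2 - 2 * b\<close> equals \<open>2 / 3\<close>; hence only \<open>q\<close> and
    \<open>r\<close> occur as boundary values there.\<close>
  define q where "q = (1 / 3 :: real) ^ Suc (Suc m)"
  define r where "r = (2 / 3 :: real) ^ Suc (Suc m)"
  have MN: "M > 0" "N > 0" "N = M + 1" by (simp_all add: M_def N_def)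
  have qr: "0 < q" "q \<le> 1" "0 < r" "r \<le> 1" by (auto simp: q_def r_def intro!: power_le_one simp del: power_Suc)
  \<comment> \<open>A conditional in place of the indicator of an interval depending on
    \<open>b\<close> exposes joint measurability in \<open>b\<close> and \<open>s\<close>.\<close>
  have "?J = (\<lambda>b. \<integral>\<^sup>+ s. ennreal (cell_length b s ^ m) * (if 0 \<le> s \<and> s \<le> b then 1 else 0) \<partial>lborel)"
    by (auto simp: indicator_def fun_eq_iff intro!: nn_integral_cong)
  then have [measurable]: "?J \<in> borel_measurable borel" by simp
  have "?I 0 (1 / 2) = (\<integral>\<^sup>+ b. ennreal ((2 * b) ^ Suc m / (2 * M)) * indicator {0..1 / 2} b \<partial>lborel)"
    unfolding M_def by (rule nn_integral_Icc_cong, rule cell_length_integral_low) auto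
  also have "\<dots> = ennreal ((2 * (1 / 2)) ^ Suc (Suc m) / (4 * M * N) - (2 * 0) ^ Suc (Suc m) / (4 * M * N))"
  proof (rule nn_integral_FTC_Icc)
    show "((\<lambda>b. (2 * b) ^ Suc (Suc m) / (4 * M * N)) has_real_derivative (2 * b) ^ Suc m / (2 * M)) (at b)" for b
      by (rule derivative_eq_intros refl | use MN in \<open>simp add: N_def[symmetric] del: of_nat_Suc power_Suc\<close>)+
  qed (use MN in auto)
  also have "\<dots> = ennreal (1 / 4 / (M * N))" by (simp add: mult.assoc)
  finally have 1: "?I 0 (1 / 2) = \<dots>" .
  let ?F = "\<lambda>b. ((2 * b - 1) ^ Suc (Suc m) / 4 + (3 - 4 * b) ^ Suc (Suc m) / 8 - (2 - 2 * b) ^ Suc (Suc m) / 2) / (M * N)"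
  have "?I (1 / 2) (2 / 3) = (\<integral>\<^sup>+ b. ennreal (((2 * b - 1) ^ Suc m / 2 - (3 - 4 * b) ^ Suc m / 2 + (2 - 2 * b) ^ Suc m) / M) * indicator {1 / 2..2 / 3} b \<partial>lborel)"
    unfolding M_def by (rule nn_integral_Icc_cong, rule cell_length_integral_mid) auto
  also have "\<dots> = ennreal (?F (2 / 3) - ?F (1 / 2))"
  proof (rule nn_integral_FTC_Icc)
    show "(?F has_real_derivative ((2 * b - 1) ^ Suc m / 2 - (3 - 4 * b) ^ Suc m / 2 + (2 - 2 * b) ^ Suc m) / M) (at b)" for b
    proof -
      have "(?F has_real_derivative (N * 2 * (2 * b - 1) ^ Suc m / 4 + N * (- 4) * (3 - 4 * b) ^ Suc m / 8
          - N * (- 2) * (2 - 2 * b) ^ Suc m / 2) / (M * N)) (at b)"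
        unfolding N_def by (intro DERIV_cdivide DERIV_add DERIV_diff DERIV_affine_power) (rule diff_conv_add_uminus | simp)+
      moreover have "(N * 2 * X / 4 + N * (- 4) * Y / 8 - N * (- 2) * Z / 2) / (M * N) = (X / 2 - Y / 2 + Z) / M" for X Y Z
        using MN(1,2) by (simp add: field_simps)
      ultimately show ?thesis by metis
    qed
    show "0 \<le> ((2 * b - 1) ^ Suc m / 2 - (3 - 4 * b) ^ Suc m / 2 + (2 - 2 * b) ^ Suc m) / M" if "b \<in> {1 / 2..2 / 3}" for b
    proof -
      have "(3 - 4 * b) ^ Suc m \<le> (2 - 2 * b) ^ Suc m" "0 \<le> (2 * b - 1) ^ Suc m" "0 \<le> (3 - 4 * b) ^ Suc m"
        using that by (auto intro!: power_mono simp del: power_Suc)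
      then show ?thesis using MN by simp
    qed
  qed auto
  also have "?F (2 / 3) - ?F (1 / 2) = (q / 4 - (1 - q) / 8 + (1 - r) / 2) / (M * N)"
    using MN by (simp add: q_def r_def diff_divide_distrib add_divide_distrib del: power_Suc)
  finally have 2: "?I (1 / 2) (2 / 3) = ennreal ((q / 4 - (1 - q) / 8 + (1 - r) / 2) / (M * N))" .
  \<comment> \<open>Found from \<open>3 * b - 2 = 1 - 3 * (1 - b)\<close>, which turns the integrand
    into powers of \<open>1 - b\<close> and \<open>2 - 2 * b\<close>.\<close>
  let ?G = "\<lambda>b. 3 * (1 - b) ^ Suc (Suc m) / N - (1 - b) ^ Suc m / M - (2 - 2 * b) ^ Suc (Suc m) / (2 * M * N)"
  have "?I (2 / 3) 1 = (\<integral>\<^sup>+ b. ennreal ((3 * b - 2) * (1 - b) ^ m + (2 - 2 * b) ^ Suc m / M) * indicator {2 / 3..1} b \<partial>lborel)"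
    unfolding M_def by (rule nn_integral_Icc_cong, rule cell_length_integral_high) auto
  also have "\<dots> = ennreal (?G 1 - ?G (2 / 3))"
  proof (rule nn_integral_FTC_Icc)
    show "(?G has_real_derivative (3 * b - 2) * (1 - b) ^ m + (2 - 2 * b) ^ Suc m / M) (at b)" for b
    proof -
      have "(?G has_real_derivative 3 * (N * (- 1) * (1 - b) ^ Suc m) / N - (M * (- 1) * (1 - b) ^ m) / M
          - (N * (- 2) * (2 - 2 * b) ^ Suc m) / (2 * M * N)) (at b)"
        unfolding N_def M_def by (intro DERIV_cdivide DERIV_cmult DERIV_diff DERIV_affine_power) simp_all
      moreover have "3 * (N * (- 1) * X) / N - (M * (- 1) * Y) / M - (N * (- 2) * Z) / (2 * M * N) = - 3 * X + Y + Z / M" for X Y Z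
        using MN(1,2) by (simp add: field_simps)
      ultimately have "(?G has_real_derivative - 3 * (1 - b) ^ Suc m + (1 - b) ^ m + (2 - 2 * b) ^ Suc m / M) (at b)"
        by metis
      moreover have "- 3 * (1 - b) ^ Suc m + (1 - b) ^ m = (3 * b - 2) * (1 - b) ^ m"
        by (simp add: algebra_simps)
      ultimately show ?thesis by simp
    qed
  qed (use MN in auto)
  also have "?G 1 - ?G (2 / 3) = (3 * q + r / 2) / (M * N)"
  proof -
    have "?G (2 / 3) = 3 * q / N - 3 * q / M - r / (2 * M * N)" by (simp add: q_def r_def)
    moreover have "?G 1 = 0" by simp
    moreover have "3 * q / M - 3 * q / N + r / (2 * M * N) = (3 * q + r / 2) / (M * N)"
    proof -
      have "1 / M - 1 / N = 1 / (M * N)" using MN by (simp add: diff_frac_eq)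
      then have "3 * q / M - 3 * q / N = 3 * q * (1 / (M * N))"
        by (simp add: right_diff_distrib[symmetric] divide_inverse mult.assoc)
      then show ?thesis by (simp add: add_divide_distrib mult.assoc)
    qed
    ultimately show ?thesis by linarith
  qed
  finally have 3: "?I (2 / 3) 1 = ennreal ((3 * q + r / 2) / (M * N))" .
  have "?I 0 1 = ?I 0 (1 / 2) + (?I (1 / 2) (2 / 3) + ?I (2 / 3) 1)"
    using nn_integral_Icc_split[of ?J 0 "1 / 2" 1] nn_integral_Icc_split[of ?J "1 / 2" "2 / 3" 1] by simp
  also have "\<dots> = ennreal (1 / 4 / (M * N) + ((q / 4 - (1 - q) / 8 + (1 - r) / 2) / (M * N) + (3 * q + r / 2) / (M * N)))"
  proof -
    \<comment> \<open>Adding the \<open>ennreal\<close> values needs nonnegative summands; the bound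
      \<open>r \<le> 1\<close> would leave the middle one possibly negative, whereas
      \<open>(1 - r) / 2 \<ge> 1 / 6\<close> outweighs \<open>1 / 8\<close>.\<close>
    have "r \<le> 2 / 3"
      unfolding r_def using power_decreasing[of 1 "Suc (Suc m)" "2 / 3 :: real"] by simp
    then have "0 \<le> q / 4 - (1 - q) / 8 + (1 - r) / 2" using qr by (simp add: field_simps)
    then show ?thesis
      unfolding 1 2 3 using qr MN by (simp add: ennreal_plus[symmetric] del: ennreal_plus)
  qed
  also have "1 / 4 / (M * N) + ((q / 4 - (1 - q) / 8 + (1 - r) / 2) / (M * N) + (3 * q + r / 2) / (M * N)) =
      (5 / 8 + 27 / 8 * q) / (M * N)"
  proof -
    have e: "1 / 4 + (q / 4 - (1 - q) / 8 + (1 - r) / 2 + (3 * q + r / 2)) = 5 / 8 + 27 / 8 * q"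
      by (simp add: field_simps)
    show ?thesis unfolding add_divide_distrib[symmetric] e ..
  qed
  also have "27 / 8 * q = 3 / (8 * 3 ^ m)" by (simp add: q_def power_divide)
  finally show ?thesis by (simp add: M_def N_def)
qed

section \<open>Symmetries of the integrand\<close>

lemma inner_mult_unit:
  fixes p z w :: complex
  assumes "norm p = 1"
  shows "(p * z) \<bullet> (p * w) = z \<bullet> w"
proof -
  have "(p * z) \<bullet> (p * w) = (Re p ^ 2 + Im p ^ 2) * (z \<bullet> w)"
    by (simp add: inner_complex_def power2_eq_square algebra_simps)
  also have "Re p ^ 2 + Im p ^ 2 = 1" using assms cmod_power2[of p] by simp
  finally show ?thesis by simp
qed

lemma pair_weight_rotate:
  assumes p: "norm p = 1"
  shows "pair_weight m p (p * b) (p * u) = pair_weight m 1 b u"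
proof -
  have inner: "p \<bullet> (p * w) = 1 \<bullet> w" "(p * w) \<bullet> p = w \<bullet> 1" "p \<bullet> p = 1" for w
    using inner_mult_unit[OF p, of 1 w] inner_mult_unit[OF p, of w 1] inner_mult_unit[OF p, of 1 1]
    by (simp_all add: inner_complex_def)
  have "cell_measure p (p * b) (p * u) = cell_measure 1 b u"
    unfolding cell_measure_def
    by (subst nn_integral_circle_rotate[OF _ p, symmetric]) (simp_all add: inner inner_mult_unit[OF p])
  then show ?thesis by (simp add: pair_weight_def inner inner_mult_unit[OF p])
qed

lemma pair_weight_cnj: "pair_weight m 1 (cnj b) (cnj u) = pair_weight m 1 b u"
proof -
  have inner: "cnj z \<bullet> cnj w = z \<bullet> w" "1 \<bullet> cnj w = 1 \<bullet> w" "cnj w \<bullet> 1 = w \<bullet> 1" for z w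
    by (simp_all add: inner_complex_def)
  have "cell_measure 1 (cnj b) (cnj u) = cell_measure 1 b u"
    unfolding cell_measure_def
    by (subst nn_integral_circle_cnj[symmetric]) (simp_all add: inner)
  then show ?thesis by (simp add: pair_weight_def inner)
qed

section \<open>The integrand in angular coordinates\<close>

lemma cos_less_cos_iff:
  "cos (2 * pi * x - pi * s) < cos (2 * pi * y - pi * s) \<longleftrightarrow> 0 < sin (pi * (x + y - s)) * sin (pi * (x - y))"
proof -
  have "cos (2 * pi * y - pi * s) - cos (2 * pi * x - pi * s) = 2 * sin (pi * (x + y - s)) * sin (pi * (x - y))"
  proof -
    have args: "(2 * pi * y - pi * s + (2 * pi * x - pi * s)) / 2 = pi * (x + y - s)"
      "(2 * pi * x - pi * s - (2 * pi * y - pi * s)) / 2 = pi * (x - y)"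
      by (simp_all add: field_simps)
    show ?thesis unfolding cos_diff_cos args ..
  qed
  then have "0 < cos (2 * pi * y - pi * s) - cos (2 * pi * x - pi * s) \<longleftrightarrow> 0 < sin (pi * (x + y - s)) * sin (pi * (x - y))"
    by (simp add: zero_less_mult_iff)
  then show ?thesis by simp
qed

lemma sin_pi_sign:
  shows "0 < t \<Longrightarrow> t < 2 \<Longrightarrow> 0 < sin (pi * t) \<longleftrightarrow> t < 1"
    and "0 < t \<Longrightarrow> t < 2 \<Longrightarrow> sin (pi * t) < 0 \<longleftrightarrow> 1 < t"
    and "- 1 < t \<Longrightarrow> t < 1 \<Longrightarrow> 0 < sin (pi * t) \<longleftrightarrow> 0 < t"
    and "- 1 < t \<Longrightarrow> t < 1 \<Longrightarrow> sin (pi * t) < 0 \<longleftrightarrow> t < 0"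
proof -
  have pos: "0 < sin (pi * t)" if "0 < t" "t < 1" for t
    using that by (intro sin_gt_zero) auto
  have neg: "sin (pi * t) < 0" if "1 < t" "t < 2" for t
    using that pos[of "t - 1"] by (simp add: right_diff_distrib sin_diff)
  have neg': "sin (pi * t) < 0" if "- 1 < t" "t < 0" for t
    using that pos[of "- t"] by simp
  show "0 < t \<Longrightarrow> t < 2 \<Longrightarrow> 0 < sin (pi * t) \<longleftrightarrow> t < 1" "0 < t \<Longrightarrow> t < 2 \<Longrightarrow> sin (pi * t) < 0 \<longleftrightarrow> 1 < t"
    using pos[of t] neg[of t] by (cases t "1::real" rule: linorder_cases; force)+
  show "- 1 < t \<Longrightarrow> t < 1 \<Longrightarrow> 0 < sin (pi * t) \<longleftrightarrow> 0 < t" "- 1 < t \<Longrightarrow> t < 1 \<Longrightarrow> sin (pi * t) < 0 \<longleftrightarrow> t < 0"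
    using pos[of t] neg'[of t] by (cases t "0::real" rule: linorder_cases; force)+
qed

lemma cis_inner_cis: "cis x \<bullet> cis y = cos (x - y)"
  by (simp add: inner_complex_def cos_diff)

text \<open>The thresholds are mirror images, measured in turns. Reflection in the axis of
  \<open>u\<close> takes \<open>1\<close> to \<open>s\<close> and \<open>\<beta>\<close> to
  \<open>1 + s - \<beta>\<close>; reflection in the real axis takes \<open>\<beta>\<close> to
  \<open>1 - \<beta>\<close>. The conditions exclude the arcs between \<open>0\<close> and
  \<open>s\<close>, between \<open>\<beta>\<close> and \<open>1 + s - \<beta>\<close>, and between
  \<open>\<beta>\<close> and \<open>1 - \<beta>\<close>. As
  \<open>1 - \<beta> < 1 + s - \<beta>\<close>, the real axis bounds the first remaining interval
  and \<open>u\<close> the second.\<close>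

lemma cell_angles:
  assumes "0 < s" "s < \<beta>" "\<beta> < 1" "0 < x" "x < 1"
  defines "q \<equiv> cis (2 * pi * x)" and "b \<equiv> cis (2 * pi * \<beta>)" and "u \<equiv> cis (pi * s)"
  shows "q \<bullet> u < 1 \<bullet> u \<and> b \<bullet> u < q \<bullet> u \<and> q \<bullet> 1 < (1::complex) \<bullet> 1 \<and> b \<bullet> 1 < q \<bullet> 1 \<longleftrightarrow>
    x \<in> {s<..<min \<beta> (1 - \<beta>)} \<union> {max \<beta> (1 + s - \<beta>)<..<1}"
proof -
  have 1: "q \<bullet> u < 1 \<bullet> u \<longleftrightarrow> s < x"
    using cos_less_cos_iff[of x s 0] assms sin_pi_sign(3,4)[of "x - s"] sin_pi_sign(3,4)[of x]
    unfolding q_def u_def cis_zero[symmetric] cis_inner_cis by (simp add: zero_less_mult_iff)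
  have 3: "q \<bullet> 1 < (1::complex) \<bullet> 1"
    using cos_less_cos_iff[of x 0 0] assms sin_pi_sign(3,4)[of x]
    unfolding q_def cis_zero[symmetric] cis_inner_cis by (simp add: zero_less_mult_iff)
  have 4: "b \<bullet> 1 < q \<bullet> 1 \<longleftrightarrow> (x < \<beta> \<and> \<beta> + x < 1) \<or> (\<beta> < x \<and> 1 < \<beta> + x)"
    using cos_less_cos_iff[of \<beta> 0 x] assms sin_pi_sign(1,2)[of "\<beta> + x"] sin_pi_sign(3,4)[of "\<beta> - x"]
    unfolding q_def b_def cis_zero[symmetric] cis_inner_cis by (auto simp: zero_less_mult_iff)
  have 2: "b \<bullet> u < q \<bullet> u \<longleftrightarrow> (x < \<beta> \<and> \<beta> + x - s < 1) \<or> (\<beta> < x \<and> 1 < \<beta> + x - s)" if "s < x"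
    using cos_less_cos_iff[of \<beta> s x] assms that sin_pi_sign(1,2)[of "\<beta> + x - s"] sin_pi_sign(3,4)[of "\<beta> - x"]
    unfolding q_def b_def u_def cis_inner_cis by (auto simp: zero_less_mult_iff)
  show ?thesis
  proof (cases "s < x")
    case True
    show ?thesis using 1 2[OF True] 3 4 True assms(1-5) by auto
  next
    case False
    then show ?thesis using 1 assms(1-5) by auto
  qed
qed

lemma cell_measure_angles:
  assumes "0 < s" "s < \<beta>" "\<beta> < 1"
  shows "cell_measure 1 (cis (2 * pi * \<beta>)) (cis (pi * s)) = ennreal (cell_length \<beta> s)"
proof -
  let ?A = "{s<..<min \<beta> (1 - \<beta>)}" and ?B = "{max \<beta> (1 + s - \<beta>)<..<1}"
  have "cell_measure 1 (cis (2 * pi * \<beta>)) (cis (pi * s)) = (\<integral>\<^sup>+ x. indicator (?A \<union> ?B) x \<partial>lborel)"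
    unfolding cell_measure_def
  proof (subst nn_integral_circle_measure, measurable, rule nn_integral_cong_AE,
      use AE_lborel_singleton[of "0::real"] in eventually_elim)
    fix x :: real assume x: "x \<noteq> 0"
    show "(if cis (2 * pi * x) \<bullet> cis (pi * s) < 1 \<bullet> cis (pi * s) \<and>
         cis (2 * pi * \<beta>) \<bullet> cis (pi * s) < cis (2 * pi * x) \<bullet> cis (pi * s) \<and>
         cis (2 * pi * x) \<bullet> 1 < (1::complex) \<bullet> 1 \<and> cis (2 * pi * \<beta>) \<bullet> 1 < cis (2 * pi * x) \<bullet> 1
        then 1 else 0) * indicator {0..<1} x = (indicator (?A \<union> ?B) x :: ennreal)"
    proof (cases "0 < x \<and> x < 1")
      case True
      then show ?thesis using cell_angles[OF assms, of x] by (simp only: indicator_def) auto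
    next
      case False
      then have "x \<notin> ?A \<union> ?B" "x \<notin> {0..<1}" using assms x by auto
      then show ?thesis by (simp only: indicator_def) simp
    qed
  qed
  also have "\<dots> = emeasure lborel ?A + emeasure lborel ?B"
    by (subst nn_integral_indicator, simp, subst plus_emeasure) auto
  \<comment> \<open>\<open>?A\<close> can be empty, whereas \<open>s < \<beta>\<close> keeps
    \<open>?B\<close> nonempty; hence \<open>max 0\<close> in the first summand only.\<close>
  also have "emeasure lborel ?A = ennreal (max 0 (min \<beta> (1 - \<beta>) - s))"
    by (cases "s \<le> min \<beta> (1 - \<beta>)") (auto simp: max_def min_def)
  also have "emeasure lborel ?B = ennreal (1 - max \<beta> (1 + s - \<beta>))"
    using assms by (subst emeasure_lborel_Ioo) auto
  also have "ennreal (max 0 (min \<beta> (1 - \<beta>) - s)) + ennreal (1 - max \<beta> (1 + s - \<beta>)) = ennreal (cell_length \<beta> s)"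
    unfolding cell_length_def by (rule ennreal_plus[symmetric]) (use assms in auto)
  finally show ?thesis .
qed

lemma cell_length_nonneg: "0 \<le> b \<Longrightarrow> b \<le> 1 \<Longrightarrow> s \<le> b \<Longrightarrow> 0 \<le> cell_length b s"
  by (auto simp: cell_length_def)

text \<open>The mirror image of \<open>1\<close> in the axis of \<open>u\<close> is
  \<open>cis (2 * pi * s)\<close>, so \<open>b\<close> lies below \<open>1\<close> in direction
  \<open>u\<close> iff \<open>s < \<beta>\<close>; this is the source of the indicator. Excluding
  \<open>s = \<beta>\<close> permits a closed interval.\<close>

lemma pair_weight_angles:
  assumes "0 < s" "s < 1" "0 < \<beta>" "\<beta> < 1" "s \<noteq> \<beta>"
  shows "pair_weight m 1 (cis (2 * pi * \<beta>)) (cis (pi * s)) = ennreal (cell_length \<beta> s ^ m) * indicator {0..\<beta>} s"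
proof -
  have "cis (2 * pi * \<beta>) \<bullet> cis (pi * s) < 1 \<bullet> cis (pi * s) \<longleftrightarrow> s < \<beta>"
    using cos_less_cos_iff[of \<beta> s 0] assms sin_pi_sign(3,4)[of "\<beta> - s"] sin_pi_sign(3,4)[of \<beta>]
    unfolding cis_zero[symmetric] cis_inner_cis by (simp add: zero_less_mult_iff)
  moreover have "cis (2 * pi * \<beta>) \<bullet> 1 < (1::complex) \<bullet> 1"
    using cos_less_cos_iff[of \<beta> 0 0] assms sin_pi_sign(3,4)[of \<beta>]
    unfolding cis_zero[symmetric] cis_inner_cis by (simp add: zero_less_mult_iff)
  ultimately show ?thesis
    using assms cell_measure_angles[of s \<beta>] cell_length_nonneg[of \<beta> s]
    by (auto simp: pair_weight_def ennreal_power indicator_def)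
qed

lemma nn_integral_pair_weight:
  "(\<integral>\<^sup>+ p. \<integral>\<^sup>+ b. \<integral>\<^sup>+ u. pair_weight m p b u \<partial>circle_measure \<partial>circle_measure \<partial>circle_measure) =
    ennreal ((5 / 8 + 3 / (8 * 3 ^ m)) / (real (Suc m) * real (Suc (Suc m))))"
proof -
  \<comment> \<open>The angular formula covers \<open>u\<close> in the upper half plane. Conjugating
    \<open>b\<close> and \<open>u\<close> together carries the lower half over to it, so the total
    is twice the upper part.\<close>
  define up where "up b u = (if 0 < Im u then pair_weight m 1 b u else 0)" for b u
  define low where "low b u = (if Im u < 0 then pair_weight m 1 b u else 0)" for b u
  have cnj_meas [measurable]: "cnj \<in> borel_measurable borel"
    by (intro borel_measurable_continuous_onI continuous_intros)
  have up_meas [measurable (raw)]: "(\<lambda>x. up (f x) (g x)) \<in> borel_measurable M"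
    if [measurable]: "f \<in> borel_measurable M" "g \<in> borel_measurable M" for f g and M :: "'a measure"
    unfolding up_def by measurable
  have low_meas [measurable (raw)]: "(\<lambda>x. low (f x) (g x)) \<in> borel_measurable M"
    if [measurable]: "f \<in> borel_measurable M" "g \<in> borel_measurable M" for f g and M :: "'a measure"
    unfolding low_def by measurable
  have "(\<integral>\<^sup>+ p. \<integral>\<^sup>+ b. \<integral>\<^sup>+ u. pair_weight m p b u \<partial>circle_measure \<partial>circle_measure \<partial>circle_measure) =
      (\<integral>\<^sup>+ p. \<integral>\<^sup>+ b. \<integral>\<^sup>+ u. pair_weight m 1 b u \<partial>circle_measure \<partial>circle_measure \<partial>circle_measure)"
  proof (rule nn_integral_cong_AE, use AE_circle_norm in eventually_elim)
    fix p :: complex assume p: "norm p = 1"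
    have "(\<integral>\<^sup>+ b. \<integral>\<^sup>+ u. pair_weight m p b u \<partial>circle_measure \<partial>circle_measure) =
        (\<integral>\<^sup>+ b. \<integral>\<^sup>+ u. pair_weight m p (p * b) u \<partial>circle_measure \<partial>circle_measure)"
      by (rule nn_integral_circle_rotate[OF _ p, symmetric]) measurable
    also have "\<dots> = (\<integral>\<^sup>+ b. \<integral>\<^sup>+ u. pair_weight m p (p * b) (p * u) \<partial>circle_measure \<partial>circle_measure)"
      by (intro nn_integral_cong nn_integral_circle_rotate[OF _ p, symmetric]) measurable
    finally show "(\<integral>\<^sup>+ b. \<integral>\<^sup>+ u. pair_weight m p b u \<partial>circle_measure \<partial>circle_measure) =
        (\<integral>\<^sup>+ b. \<integral>\<^sup>+ u. pair_weight m 1 b u \<partial>circle_measure \<partial>circle_measure)"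
      by (simp add: pair_weight_rotate[OF p])
  qed
  also have "\<dots> = (\<integral>\<^sup>+ b. \<integral>\<^sup>+ u. pair_weight m 1 b u \<partial>circle_measure \<partial>circle_measure)"
    by (simp add: circle.emeasure_space_1[simplified])
  also have "\<dots> = (\<integral>\<^sup>+ b. (\<integral>\<^sup>+ u. up b u \<partial>circle_measure) + (\<integral>\<^sup>+ u. low b u \<partial>circle_measure) \<partial>circle_measure)"
  proof (rule nn_integral_cong)
    fix b
    have "{z. \<i> \<bullet> z = 0} \<in> null_sets circle_measure" by (rule line_null_sets) simp
    then have "AE u in circle_measure. Im u \<noteq> 0" by (rule AE_I') (auto simp: inner_complex_def)
    then have "(\<integral>\<^sup>+ u. pair_weight m 1 b u \<partial>circle_measure) = (\<integral>\<^sup>+ u. up b u + low b u \<partial>circle_measure)"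
      by (intro nn_integral_cong_AE) (auto simp: up_def low_def elim!: eventually_mono)
    also have "\<dots> = (\<integral>\<^sup>+ u. up b u \<partial>circle_measure) + (\<integral>\<^sup>+ u. low b u \<partial>circle_measure)"
      by (rule nn_integral_add) measurable
    finally show "(\<integral>\<^sup>+ u. pair_weight m 1 b u \<partial>circle_measure) = \<dots>" .
  qed
  also have "\<dots> = (\<integral>\<^sup>+ b. \<integral>\<^sup>+ u. up b u \<partial>circle_measure \<partial>circle_measure) +
      (\<integral>\<^sup>+ b. \<integral>\<^sup>+ u. low b u \<partial>circle_measure \<partial>circle_measure)"
    by (rule nn_integral_add) measurable
  also have "(\<integral>\<^sup>+ b. \<integral>\<^sup>+ u. low b u \<partial>circle_measure \<partial>circle_measure) =
      (\<integral>\<^sup>+ b. \<integral>\<^sup>+ u. low (cnj b) u \<partial>circle_measure \<partial>circle_measure)"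
    by (rule nn_integral_circle_cnj[symmetric]) measurable
  also have "\<dots> = (\<integral>\<^sup>+ b. \<integral>\<^sup>+ u. low (cnj b) (cnj u) \<partial>circle_measure \<partial>circle_measure)"
    by (intro nn_integral_cong nn_integral_circle_cnj[symmetric]) measurable
  also have "\<dots> = (\<integral>\<^sup>+ b. \<integral>\<^sup>+ u. up b u \<partial>circle_measure \<partial>circle_measure)"
  proof -
    have "low (cnj b) (cnj u) = up b u" for b u by (simp add: up_def low_def pair_weight_cnj)
    then show ?thesis by simp
  qed
  also have "(\<integral>\<^sup>+ b. \<integral>\<^sup>+ u. up b u \<partial>circle_measure \<partial>circle_measure) =
      (\<integral>\<^sup>+ b. \<integral>\<^sup>+ s. ennreal (1 / 2) * (pair_weight m 1 b (cis (pi * s)) * indicator {0<..<1} s) \<partial>lborel \<partial>circle_measure)"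
  proof (rule nn_integral_cong)
    fix b
    have "(\<integral>\<^sup>+ u. up b u \<partial>circle_measure) =
        (\<integral>\<^sup>+ t. pair_weight m 1 b (cis (2 * pi * t)) * indicator {0<..<1 / 2} t \<partial>lborel)"
    proof (subst nn_integral_circle_measure, measurable, rule nn_integral_cong)
      fix t :: real
      have "0 < Im (cis (2 * pi * t)) \<longleftrightarrow> 0 < t \<and> t < 1 / 2" if "0 \<le> t" "t < 1"
        using that sin_pi_sign(1)[of "2 * t"] by (cases "t = 0") (auto simp: mult.left_commute mult.assoc)
      then show "up b (cis (2 * pi * t)) * indicator {0..<1} t = pair_weight m 1 b (cis (2 * pi * t)) * indicator {0<..<1 / 2} t"
        by (auto simp: up_def indicator_def)
    qed
    also have "\<dots> = ennreal (1 / 2) * (\<integral>\<^sup>+ s. pair_weight m 1 b (cis (pi * s)) * indicator {0<..<1} s \<partial>lborel)"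
      by (subst nn_integral_real_affine[where c = "1 / 2" and t = 0])
        (auto simp: indicator_def intro!: arg_cong2[where f = times] nn_integral_cong)
    finally show "(\<integral>\<^sup>+ u. up b u \<partial>circle_measure) =
        (\<integral>\<^sup>+ s. ennreal (1 / 2) * (pair_weight m 1 b (cis (pi * s)) * indicator {0<..<1} s) \<partial>lborel)"
      by (subst nn_integral_cmult) auto
  qed
  also have "\<dots> = (\<integral>\<^sup>+ \<beta>. ennreal (1 / 2) * ((\<integral>\<^sup>+ s. ennreal (cell_length \<beta> s ^ m) * indicator {0..\<beta>} s \<partial>lborel) * indicator {0..1} \<beta>) \<partial>lborel)"
  proof (subst nn_integral_circle_measure, measurable, rule nn_integral_cong_AE,
      use AE_lborel_singleton[of "0::real"] AE_lborel_singleton[of "1::real"] in eventually_elim)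
    fix \<beta> :: real assume ne: "\<beta> \<noteq> 0" "\<beta> \<noteq> 1"
    show "(\<integral>\<^sup>+ s. ennreal (1 / 2) * (pair_weight m 1 (cis (2 * pi * \<beta>)) (cis (pi * s)) * indicator {0<..<1} s) \<partial>lborel) * indicator {0..<1} \<beta> =
        ennreal (1 / 2) * ((\<integral>\<^sup>+ s. ennreal (cell_length \<beta> s ^ m) * indicator {0..\<beta>} s \<partial>lborel) * indicator {0..1} \<beta>)"
    proof (cases "0 < \<beta> \<and> \<beta> < 1")
      case True
      have "(\<integral>\<^sup>+ s. pair_weight m 1 (cis (2 * pi * \<beta>)) (cis (pi * s)) * indicator {0<..<1} s \<partial>lborel) =
          (\<integral>\<^sup>+ s. ennreal (cell_length \<beta> s ^ m) * indicator {0..\<beta>} s \<partial>lborel)"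
      proof (rule nn_integral_cong_AE, use AE_lborel_singleton[of "0::real"] AE_lborel_singleton[of \<beta>] in eventually_elim)
        fix s :: real assume "s \<noteq> 0" "s \<noteq> \<beta>"
        then show "pair_weight m 1 (cis (2 * pi * \<beta>)) (cis (pi * s)) * indicator {0<..<1} s = ennreal (cell_length \<beta> s ^ m) * indicator {0..\<beta>} s"
          using True pair_weight_angles[of s \<beta> m] by (cases "0 < s \<and> s < 1") auto
      qed
      then show ?thesis using True by (subst nn_integral_cmult) auto
    qed (use ne in auto)
  qed
  \<comment> \<open>The two equal halves absorb the factor \<open>1 / 2\<close>, which stems from
    \<open>s\<close> being twice the fraction of the circle.\<close>
  also have "\<dots> + \<dots> = (\<integral>\<^sup>+ \<beta>. (\<integral>\<^sup>+ s. ennreal (cell_length \<beta> s ^ m) * indicator {0..\<beta>} s \<partial>lborel) * indicator {0..1} \<beta> \<partial>lborel)"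
  proof -
    have "(\<lambda>\<beta>. \<integral>\<^sup>+ s. ennreal (cell_length \<beta> s ^ m) * indicator {0..\<beta>} s \<partial>lborel) =
        (\<lambda>\<beta>. \<integral>\<^sup>+ s. ennreal (cell_length \<beta> s ^ m) * (if 0 \<le> s \<and> s \<le> \<beta> then 1 else 0) \<partial>lborel)"
      by (auto simp: indicator_def fun_eq_iff intro!: nn_integral_cong)
    then have "(\<lambda>\<beta>. \<integral>\<^sup>+ s. ennreal (cell_length \<beta> s ^ m) * indicator {0..\<beta>} s \<partial>lborel) \<in> borel_measurable lborel"
      by simp
    then have "(\<lambda>\<beta>. (\<integral>\<^sup>+ s. ennreal (cell_length \<beta> s ^ m) * indicator {0..\<beta>} s \<partial>lborel) * indicator {0..1} \<beta>) \<in> borel_measurable lborel"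
      by (rule borel_measurable_times_ennreal) simp
    moreover have "ennreal (1 / 2) * x + ennreal (1 / 2) * x = x" for x
    proof -
      have "ennreal (1 / 2) + ennreal (1 / 2) = 1" by (subst ennreal_plus[symmetric]) auto
      then show ?thesis by (metis distrib_right mult_1)
    qed
    ultimately show ?thesis by (simp add: nn_integral_cmult)
  qed
  finally show ?thesis by (simp only: cell_length_integral)
qed

section \<open>The expected length\<close>

lemma sets_extremal_at:
  assumes "i < n" "j < n"
  shows "{w \<in> space (Pi\<^sub>M {..<n} (\<lambda>_. circle_measure) \<Otimes>\<^sub>M circle_measure). extremal_at n i j (fst w) (snd w)}
    \<in> sets (Pi\<^sub>M {..<n} (\<lambda>_. circle_measure) \<Otimes>\<^sub>M circle_measure)"
  using pred_extremal_at[OF assms] by (simp add: pred_def)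

lemma borel_measurable_emeasure_extremal_at:
  assumes "i < n" "j < n"
  shows "(\<lambda>x. emeasure circle_measure {u. extremal_at n i j x u}) \<in> borel_measurable (Pi\<^sub>M {..<n} (\<lambda>_. circle_measure))"
  by (rule measurable_cong[THEN iffD1, OF _ circle.measurable_emeasure_Pair[OF sets_extremal_at[OF assms]]])
    (auto simp: vimage_def space_pair_measure)

lemma pred_circle_component_eq:
  assumes "i < n" "j < n"
  shows "Measurable.pred (Pi\<^sub>M {..<n} (\<lambda>_. circle_measure)) (\<lambda>x. x i = x j)"
  using measurable_equality_set[OF borel_measurable_circle_component[OF assms(1)] borel_measurable_circle_component[OF assms(2)]]
  by (simp add: pred_def)

lemma empty_length_image:
  assumes "n \<ge> 2"
  shows "empty_length n (x ` {..<n}) =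
    (if (\<forall>k\<in>{..<n}. norm (x k) = 1) \<and> inj_on x {..<n}
     then 1 - (\<Sum>i<n. \<Sum>j<n. measure circle_measure {u. extremal_at n i j x u}) else 0)"
proof (cases "(\<forall>k\<in>{..<n}. norm (x k) = 1) \<and> inj_on x {..<n}")
  case True
  then have S: "finite (x ` {..<n})" "x ` {..<n} \<subseteq> sphere 0 1" "card (x ` {..<n}) = n"
    by (auto simp: card_image)
  have "empty_length n (x ` {..<n}) = 1 - (\<Sum>p\<in>x ` {..<n}. \<Sum>b\<in>x ` {..<n}.
      measure circle_measure {u. extremal (x ` {..<n}) u p b \<and> extremal (x ` {..<n}) p p b})"
    using empty_length_eq[OF S(1,2)] S(3) assms by simp
  also have "\<dots> = 1 - (\<Sum>i<n. \<Sum>j<n. measure circle_measure {u. extremal_at n i j x u})"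
    using True by (simp add: sum.reindex extremal_at_iff)
  finally show ?thesis using True by simp
next
  case False
  have "x ` {..<n} \<noteq> {}" using assms by (auto simp: lessThan_empty_iff)
  moreover have "\<not> (x ` {..<n} \<subseteq> sphere 0 1 \<and> card (x ` {..<n}) = n)"
    using False eq_card_imp_inj_on[of "{..<n}" x] by (auto simp: subset_iff)
  ultimately show ?thesis unfolding if_not_P[OF False] by (rule empty_length_degenerate)
qed

lemma AE_PiM_circle_distinct:
  fixes n :: nat
  shows "AE x in Pi\<^sub>M {..<n} (\<lambda>_. circle_measure). (\<forall>k\<in>{..<n}. norm (x k) = 1) \<and> inj_on x {..<n}"
proof -
  let ?P = "Pi\<^sub>M {..<n} (\<lambda>_. circle_measure)"
  have norm: "AE x in ?P. norm (x k) = 1" if "k < n" for k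
    using that AE_circle_norm by (intro AE_PiM_component prob_space_circle_measure) auto
  have neq: "AE x in ?P. x i \<noteq> x j" if ij: "i < n" "j < n" "i \<noteq> j" for i j
  proof -
    define K where "K = {..<n} - {i, j}"
    have K: "finite K" "i \<notin> K" "j \<notin> K" "insert i (insert j K) = {..<n}"
      using ij by (auto simp: K_def)
    note [measurable] = pred_circle_component_eq[OF ij(1,2)]
    have "(\<integral>\<^sup>+ x. (if x i = x j then 1 else 0) \<partial>?P) =
        (\<integral>\<^sup>+ p. \<integral>\<^sup>+ b. \<integral>\<^sup>+ x. (if p = b then 1 else 0) \<partial>Pi\<^sub>M K (\<lambda>_. circle_measure) \<partial>circle_measure \<partial>circle_measure)"
      using nn_integral_PiM_insert2[OF K(1-3) ij(3), of "\<lambda>x. if x i = x j then 1 else 0"] ij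
      unfolding K(4) by simp
    \<comment> \<open>For fixed \<open>p\<close> the event \<open>b = p\<close> is a single point of
      the circle.\<close>
    also have "\<dots> = (\<integral>\<^sup>+ p. \<integral>\<^sup>+ b. 0 \<partial>circle_measure \<partial>circle_measure)"
    proof (rule nn_integral_cong, rule nn_integral_cong_AE)
      fix p
      show "AE b in circle_measure. (\<integral>\<^sup>+ x. (if p = b then 1 else 0) \<partial>Pi\<^sub>M K (\<lambda>_. circle_measure)) = 0"
        using AE_circle_neq[of p] by eventually_elim auto
    qed
    finally have "(\<integral>\<^sup>+ x. (if x i = x j then 1 else 0) \<partial>?P) = 0" by simp
    moreover have "(\<lambda>x. if x i = x j then 1 else 0 :: ennreal) \<in> borel_measurable ?P"
      by measurable
    ultimately have "AE x in ?P. (if x i = x j then 1 else 0 :: ennreal) = 0"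
      by (simp only: nn_integral_0_iff_AE)
    then show ?thesis by eventually_elim (simp split: if_splits)
  qed
  have "AE x in ?P. \<forall>k\<in>{..<n}. norm (x k) = 1"
    by (intro AE_finite_allI norm) auto
  moreover have "AE x in ?P. \<forall>i\<in>{..<n}. \<forall>j\<in>{..<n} - {i}. x i \<noteq> x j"
    by (intro AE_finite_allI neq) auto
  ultimately show ?thesis
    by eventually_elim (auto simp: inj_on_def)
qed

lemma expectation_empty_length:
  assumes n: "n \<ge> 3"
  shows "(\<lambda>x. empty_length n (x ` {..<n})) \<in> borel_measurable (Pi\<^sub>M {..<n} (\<lambda>_. circle_measure))"
    and "(\<integral>x. empty_length n (x ` {..<n}) \<partial>Pi\<^sub>M {..<n} (\<lambda>_. circle_measure)) = 3 / 8 - 1 / (8 * 3 ^ (n - 3))"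
proof -
  let ?P = "Pi\<^sub>M {..<n} (\<lambda>_. circle_measure)"
  define g where "g i j x = measure circle_measure {u. extremal_at n i j x u}" for i j x
  \<comment> \<open>The triple integral for \<open>m = n - 2\<close>, where \<open>Suc m\<close> and
    \<open>Suc (Suc m)\<close> are \<open>n - 1\<close> and \<open>n\<close>. The sum over ordered
    pairs of distinct indices cancels this denominator.\<close>
  define V where "V = (5 / 8 + 3 / (8 * 3 ^ (n - 2))) / (real (n - 1) * real n)"
  interpret P: prob_space ?P by (intro prob_space_PiM prob_space_circle_measure)
  have g_meas [measurable]: "g i j \<in> borel_measurable ?P" if "i < n" "j < n" for i j
    unfolding g_def measure_def using borel_measurable_emeasure_extremal_at[OF that] by measurable
  have sum_meas: "(\<lambda>x. 1 - (\<Sum>i<n. \<Sum>j<n. g i j x)) \<in> borel_measurable ?P"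
    by (intro borel_measurable_diff borel_measurable_sum borel_measurable_const g_meas) auto
  have "Measurable.pred ?P (\<lambda>x. norm (x k) = 1)" if "k < n" for k
    using borel_measurable_circle_component[OF that] by measurable
  moreover have "Measurable.pred ?P (\<lambda>x. x i = x j \<longrightarrow> i = j)" if "i < n" "j < n" for i j
  proof (cases "i = j")
    case False
    then show ?thesis using pred_circle_component_eq[OF that] by simp
  qed simp
  ultimately have "Measurable.pred ?P (\<lambda>x. (\<forall>k\<in>{..<n}. norm (x k) = 1) \<and> (\<forall>i\<in>{..<n}. \<forall>j\<in>{..<n}. x i = x j \<longrightarrow> i = j))"
    by (intro pred_intros_logic(3) pred_intros_finite(3) finite_lessThan) simp_all
  then have good: "Measurable.pred ?P (\<lambda>x. (\<forall>k\<in>{..<n}. norm (x k) = 1) \<and> inj_on x {..<n})"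
    unfolding inj_on_def .
  have eq: "(\<lambda>x. empty_length n (x ` {..<n})) = (\<lambda>x. if (\<forall>k\<in>{..<n}. norm (x k) = 1) \<and> inj_on x {..<n}
     then 1 - (\<Sum>i<n. \<Sum>j<n. g i j x) else 0)"
    using empty_length_image[of n] n by (simp add: g_def fun_eq_iff)
  show m: "(\<lambda>x. empty_length n (x ` {..<n})) \<in> borel_measurable ?P"
    unfolding eq using good sum_meas by measurable
  have g_int: "integrable ?P (g i j)" if "i < n" "j < n" for i j
    using g_meas[OF that] by (intro P.integrable_const_bound[of _ 1]) (auto simp: g_def)
  have V_nonneg: "0 \<le> V" by (simp add: V_def)
  have g_val: "(\<integral>x. g i j x \<partial>?P) = (if i = j then 0 else V)" if ij: "i < n" "j < n" for i j
  proof (cases "i = j")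
    case True
    \<comment> \<open>Compared with a second index, \<open>i\<close> cannot be both the strict
      maximizer and the strict minimizer, so the diagonal terms vanish.\<close>
    have "\<exists>k<n. k \<noteq> i" using n by (intro exI[of _ "if i = 0 then 1 else 0"]) auto
    then have "\<not> extremal_at n i j x u" for x u
      unfolding extremal_at_def True by (meson order.asym)
    then show ?thesis using True by (simp add: g_def)
  next
    case False
    have sucs: "Suc (n - 2) = n - 1" "Suc (n - 1) = n" using n by auto
    have "(\<integral>x. g i j x \<partial>?P) = enn2real (\<integral>\<^sup>+ x. ennreal (g i j x) \<partial>?P)"
      by (rule integral_eq_nn_integral[OF g_meas[OF ij]]) (simp add: g_def)
    also have "(\<integral>\<^sup>+ x. ennreal (g i j x) \<partial>?P) = ennreal V"
      unfolding g_def circle.emeasure_eq_measure[symmetric] nn_integral_extremal_at[OF ij False]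
        nn_integral_pair_weight V_def sucs ..
    finally show ?thesis using V_nonneg False by simp
  qed
  have "(\<integral>x. empty_length n (x ` {..<n}) \<partial>?P) = (\<integral>x. 1 - (\<Sum>i<n. \<Sum>j<n. g i j x) \<partial>?P)"
    by (rule integral_cong_AE[OF m sum_meas], use AE_PiM_circle_distinct[of n] in eventually_elim)
      (simp add: fun_cong[OF eq])
  also have "\<dots> = 1 - (\<Sum>i<n. \<Sum>j<n. if i = j then 0 else V)"
  proof -
    have row: "integrable ?P (\<lambda>x. \<Sum>j<n. g i j x)" if "i < n" for i
      using g_int that by (intro Bochner_Integration.integrable_sum) simp
    have "(\<integral>x. (\<Sum>i<n. \<Sum>j<n. g i j x) \<partial>?P) = (\<Sum>i<n. \<integral>x. (\<Sum>j<n. g i j x) \<partial>?P)"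
      using row by (intro Bochner_Integration.integral_sum) simp
    also have "\<dots> = (\<Sum>i<n. \<Sum>j<n. \<integral>x. g i j x \<partial>?P)"
      using g_int by (intro sum.cong Bochner_Integration.integral_sum) simp_all
    also have "\<dots> = (\<Sum>i<n. \<Sum>j<n. if i = j then 0 else V)"
      by (intro sum.cong refl g_val) simp_all
    finally show ?thesis
      using g_int by (subst Bochner_Integration.integral_diff) (auto simp: P.prob_space intro!: Bochner_Integration.integrable_sum)
  qed
  also have "(\<Sum>i<n. \<Sum>j<n. if i = j then 0 else V) = real n * (real (n - 1) * V)"
  proof -
    have "(\<Sum>j<n. if i = j then 0 else V) = real (n - 1) * V" if "i < n" for i
    proof -
      have "(\<Sum>j<n. if i = j then 0 else V) = (\<Sum>j\<in>{..<n} - {i}. V)"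
        by (rule sum.mono_neutral_cong_right) auto
      then show ?thesis using that by simp
    qed
    then show ?thesis using n by (simp add: of_nat_diff)
  qed
  also have "real n * (real (n - 1) * V) = 5 / 8 + 3 / (8 * 3 ^ (n - 2))"
    using n by (simp add: V_def)
  \<comment> \<open>One factor 3 of the power cancels the numerator in
    \<open>3 / (8 * 3 ^ (n - 2))\<close>.\<close>
  also have "n - 2 = Suc (n - 3)" using n by simp
  finally show "(\<integral>x. empty_length n (x ` {..<n}) \<partial>?P) = 3 / 8 - 1 / (8 * 3 ^ (n - 3))"
    by simp
qed

theorem corollary9:
  fixes M :: "'a measure" and X :: "nat \<Rightarrow> 'a \<Rightarrow> complex" and n :: nat
  assumes "prob_space M"
    and "n \<ge> 3"
    and "prob_space.indep_vars M (\<lambda>_. borel) X {..<n}"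
    and "\<And>i. i < n \<Longrightarrow> distr M borel (X i) = circle_measure"
  shows "prob_space.expectation M (\<lambda>\<omega>. empty_length n ((\<lambda>i. X i \<omega>) ` {..<n})) =
           3 / 8 - 1 / (8 * 3 ^ (n - 3))"
proof -
  interpret prob_space M by fact
  \<comment> \<open>Restriction to \<open>{..<n}\<close> puts the random vector into the extensional
    product space without changing the set of points.\<close>
  let ?T = "\<lambda>\<omega>. \<lambda>i\<in>{..<n}. X i \<omega>"
  let ?L = "\<lambda>x. empty_length n (x ` {..<n})"
  have rv: "random_variable borel (X i)" if "i \<in> {..<n}" for i
    using assms(3) that unfolding indep_vars_def by auto
  have "distr M (\<Pi>\<^sub>M i\<in>{..<n}. borel) ?T = (\<Pi>\<^sub>M i\<in>{..<n}. distr M borel (X i))"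
    using indep_vars_iff_distr_eq_PiM'[of "{..<n}" X "\<lambda>_. borel"] rv assms(2,3)
    by (auto simp: lessThan_empty_iff)
  also have "\<dots> = Pi\<^sub>M {..<n} (\<lambda>_. circle_measure)"
    using assms(4) by (intro PiM_cong) auto
  finally have distr: "distr M (\<Pi>\<^sub>M i\<in>{..<n}. borel) ?T = Pi\<^sub>M {..<n} (\<lambda>_. circle_measure)" .
  \<comment> \<open>Transport along \<open>?T\<close> requires measurability for the product of
    Borel algebras; the factors of the circle product carry the same sets.\<close>
  have "sets (\<Pi>\<^sub>M i\<in>{..<n}. borel) = sets (Pi\<^sub>M {..<n} (\<lambda>_. circle_measure))"
    by (intro sets_PiM_cong) auto
  then have "?L \<in> borel_measurable (\<Pi>\<^sub>M i\<in>{..<n}. borel)"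
    using expectation_empty_length(1)[OF assms(2)] measurable_cong_sets by blast
  moreover have "?T \<in> measurable M (\<Pi>\<^sub>M i\<in>{..<n}. borel)"
    using rv by (intro measurable_restrict) auto
  ultimately have "expectation (\<lambda>\<omega>. ?L (?T \<omega>)) = (\<integral>x. ?L x \<partial>distr M (\<Pi>\<^sub>M i\<in>{..<n}. borel) ?T)"
    by (intro integral_distr[symmetric])
  also have "\<dots> = 3 / 8 - 1 / (8 * 3 ^ (n - 3))"
    unfolding distr by (rule expectation_empty_length(2)) fact
  finally show ?thesis by (simp add: image_restrict_eq)
qed

end
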